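(* Let $G$ be a subcubic graph that satisfies one of the following: (a) $G$ is $0$-saturated and $g_3(G)\le 4$; (b) $G$ is $1$-saturated and $g_3(G)=3$. Then $G$ is $S$-packing colorable whenever one of the following holds: (i) $S=(1,1,3,k)$ for any integer $k\ge 3$; (ii) $S=(1,2,2,3)$; (iii) $S=(2,2,2,2,3)$ and $G\neq \mathcal{G}_1$; (iv) $S=(1,2,3,4,5,k)$ for any integer $k\ge 6$.
   Context: All graphs are finite, simple and undirected; $dist_G$ denotes the distance in $G$. For a non-decreasing sequence $S=(s_1,\dots,s_k)$ of positive integers, an $S$-packing coloring of $G$ is a partition of $V(G)$ into sets $V_1,\dots,V_k$ such that any two distinct vertices $u,v\in V_i$ satisfy $dist_G(u,v)>s_i$; $G$ is $S$-packing colorable if it admits one. A $k$-vertex is a vertex of degree $k$. $G$ is subcubic if its maximum degree is at most $3$. A subcubic graph is $k$-saturated ($0\le k\le 3$) if every $3$-vertex is adjacent to at most $k$ vertices of degree $3$. The local girth $g(v)$ of a vertex $v$ is the length of a shortest cycle containing $v$ ($\infty$ if none), and $g_3(G)=\max\{g(v): d_G(v)=3\}$. The graph $\mathcal{G}_1$ has vertices $v_1,\dots,v_6$ and edges $v_1v_2,v_2v_3,v_3v_4,v_4v_5,v_5v_1,v_5v_6,v_3v_6$ (a $5$-cycle $v_1v_2v_3v_4v_5$ plus a vertex $v_6$ adjacent to $v_3$ and $v_5$).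
   Formalization: In (iii), "G ≠ G_1" is replaced by "no connected component of G is isomorphic to G_1", since a disconnected graph such as G_1 plus an isolated vertex meets the stated hypotheses but is not (2,2,2,2,3)-packing colorable. *)

theory Defs
  imports
    "Graph_Theory.Graph_Theory"
    "HOL-Library.Extended_Nat"
    "HOL-Library.Disjoint_Sets"
begin

text \<open>
  A finite simple undirected graph is a \<^locale>\<open>pair_graph\<close>: a finite, loop-free, symmetric
  digraph without parallel arcs, each edge \<open>uv\<close> being the pair of arcs \<open>(u, v)\<close>, \<open>(v, u)\<close>. Hence
  the degree of a vertex is its out-degree.
\<close>

abbreviation vdegree :: "'a pair_pre_digraph \<Rightarrow> 'a \<Rightarrow> nat" where
  "vdegree G v \<equiv> out_degree (with_proj G) v"

definition subcubic :: "'a pair_pre_digraph \<Rightarrow> bool" where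
  "subcubic G \<longleftrightarrow> (\<forall>v \<in> pverts G. vdegree G v \<le> 3)"

definition saturated :: "nat \<Rightarrow> 'a pair_pre_digraph \<Rightarrow> bool" where
  "saturated k G \<longleftrightarrow> subcubic G \<and>
    (\<forall>v \<in> pverts G. vdegree G v = 3 \<longrightarrow>
       card {u \<in> pverts G. (v, u) \<in> parcs G \<and> vdegree G u = 3} \<le> k)"

text \<open>
  The value is \<open>\<infinity>\<close> for vertices in different components.
\<close>

definition gdist :: "'a pair_pre_digraph \<Rightarrow> 'a \<Rightarrow> 'a \<Rightarrow> ereal" where
  "gdist G u v = wf_digraph.\<mu> (with_proj G) (\<lambda>_. 1) u v"

text \<open>
  The library's \<^const>\<open>pre_digraph.cycle\<close> also admits the closed walk of length 2 running back and
  forth along one edge, which is not a cycle of the undirected graph; hence \<open>3 \<le> length p\<close>. The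
  vertices of a cycle are the tails of its arcs. \<open>Inf {} = \<infinity>\<close> for vertices on no cycle.
\<close>

definition local_girth :: "'a pair_pre_digraph \<Rightarrow> 'a \<Rightarrow> enat" where
  "local_girth G v =
     (INF p \<in> {p. pre_digraph.cycle (with_proj G) p \<and> 3 \<le> length p \<and> v \<in> fst ` set p}.
        enat (length p))"

text \<open>
  For a finite graph with a vertex of degree 3 the supremum is a maximum; without such a vertex
  it is 0.
\<close>

definition g3 :: "'a pair_pre_digraph \<Rightarrow> enat" where
  "g3 G = (SUP v \<in> {v \<in> pverts G. vdegree G v = 3}. local_girth G v)"

text \<open>
  Colour classes are indexed from 0 and may be empty.
\<close>

definition packing_colorable :: "nat list \<Rightarrow> 'a pair_pre_digraph \<Rightarrow> bool" where
  "packing_colorable S G \<longleftrightarrow>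
    (\<exists>V :: nat \<Rightarrow> 'a set.
       (\<Union>i < length S. V i) = pverts G \<and>
       disjoint_family_on V {..<length S} \<and>
       (\<forall>i < length S. \<forall>u \<in> V i. \<forall>v \<in> V i.
          u \<noteq> v \<longrightarrow> gdist G u v > ereal (real (S ! i))))"

definition graph_G1 :: "nat pair_pre_digraph" where
  "graph_G1 =
    \<lparr> pverts = {1..6},
      parcs = symcl {(1,2), (2,3), (3,4), (4,5), (5,1), (5,6), (3,6)} \<rparr>"

text \<open>
  For connected \<open>G\<close> this says that \<open>G\<close> is isomorphic to \<^const>\<open>graph_G1\<close>. On a symmetric digraph,
  the strongly connected components are the connected components of the undirected graph.
\<close>

definition has_G1_component :: "'a pair_pre_digraph \<Rightarrow> bool" where
  "has_G1_component G \<longleftrightarrow>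
    (\<exists>H \<in> pre_digraph.sccs (with_proj G). digraph_iso H (with_proj graph_G1))"

end

theory Submission
  imports Defs
begin

text \<open>
  Deleting a suitable set \<open>E\<close> of degree-2 vertices, one next to each 3-vertex and pairwise at
  distance at least 4, leaves a core of maximum degree 2. Every deleted vertex is dominated by a core
  vertex, so \<open>G\<close> retracts onto the core and the core is isometric in \<open>G\<close>; hence \<open>E\<close> can take a colour
  of value 3 and the core, a union of paths and cycles, is coloured periodically with the other
  colours. A path is treated as part of a cycle that is longer by 6. Exceptions are two triangles
  joined by an edge, where no such \<open>E\<close> exists, and 5-cycles in the core, since 5 is not of the form
  \<open>3a + 4b\<close>; both are coloured by hand, and the 5-cycle with a doubled vertex is \<open>\<G>\<^sub>1\<close>.
\<close>

section \<open>Periodic colourings of cycles\<close>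

text \<open>The difficulty is that \<open>E\<close> must be sparse and still meet the neighbourhood
  of every 3-vertex. A maximal separated set of candidates does both if candidates at distance at
  most 3 are exchangeable, that is, if every 3-vertex next to one of them is next to the other: a
  rejected candidate can then be replaced by a chosen one that blocked it. Cases (a) and (b) differ
  in which candidates have this property; in case (b) it can fail only at two triangles joined by an
  edge. Domination means that all neighbours of a deleted vertex q are equal or adjacent to one
  vertex r; sending q to r does not lengthen walks. The colours are read off a map into the integers
  modulo N that changes by at most 1 along each edge. A conflict in \<open>G\<close> then forces a
  conflict on the cycle of length N, and this argument also covers a path placed on a longer
  cycle.\<close>

definition cyclic_coloring :: "nat list \<Rightarrow> nat \<Rightarrow> (nat \<Rightarrow> nat) \<Rightarrow> bool" where
  "cyclic_coloring S N f \<longleftrightarrow>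
     (\<forall>i<N. f i < length S \<and>
        (\<forall>d. 1 \<le> d \<and> d \<le> S ! f i \<and> \<not> N dvd d \<longrightarrow> f ((i + d) mod N) \<noteq> f i))"

lemma mod_add_less_cases:
  fixes i d N :: nat
  assumes "i < N" "d \<le> N"
  shows "(i + d) mod N = (if i + d < N then i + d else i + d - N)"
  using assms by (auto simp: mod_if)

text \<open>A value above \<open>N\<close> allows steps around the whole cycle, so its colour may
  occur only once. For the other values a step is shorter than \<open>N\<close> and crosses the seam
  at most once. The last hypothesis separates the two situations.\<close>

lemma cyclic_coloringI:
  assumes "\<And>i. i < N \<Longrightarrow> f i < length S"
    and "\<And>i d. i + d < N \<Longrightarrow> 1 \<le> d \<Longrightarrow> d \<le> S ! f i \<Longrightarrow> f (i + d) \<noteq> f i"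
    and "\<And>i d. i < N \<Longrightarrow> N \<le> i + d \<Longrightarrow> d < N \<Longrightarrow> d \<le> S ! f i \<Longrightarrow> f (i + d - N) \<noteq> f i"
    and "\<And>i. i < N \<Longrightarrow> S ! f i \<le> N \<or> (\<forall>j<N. j \<noteq> i \<longrightarrow> f j \<noteq> f i)"
  shows "cyclic_coloring S N f"
  unfolding cyclic_coloring_def
proof (intro allI impI conjI)
  fix i assume i: "i < N"
  show "f i < length S" by (rule assms(1)[OF i])
  fix d assume d: "1 \<le> d \<and> d \<le> S ! f i \<and> \<not> N dvd d"
  have "(i + d) mod N \<noteq> i"
  proof
    assume "(i + d) mod N = i"
    hence "(i + d) mod N = i mod N" using i by simp
    hence "N dvd (i + d) - i" by (metis mod_eq_dvd_iff_nat le_add1)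
    thus False using d by simp
  qed
  moreover have "(i + d) mod N < N" using i by simp
  moreover have "f ((i + d) mod N) \<noteq> f i" if "S ! f i \<le> N"
  proof -
    have "d < N" using d that by (metis dvd_refl le_neq_implies_less order.trans)
    thus ?thesis using assms(2)[of i d] assms(3)[of i d] i d
      by (auto simp: mod_add_less_cases)
  qed
  ultimately show "f ((i + d) mod N) \<noteq> f i" using assms(4)[OF i] by blast
qed

text \<open>Colours 0 and 1 alternate; an odd cycle is repaired at its last position by a single use
  of the colour of value \<open>k\<close>, which is legal for every \<open>k\<close>. Colour 2, of
  value 3, stays free for the deleted vertices.\<close>

lemma cyclic_coloring_11k:
  assumes "3 \<le> N"
  shows "\<exists>f. cyclic_coloring [1, 1, 3, k] N f \<and> (\<forall>i<N. f i \<noteq> 2)"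
proof -
  define l where "l i \<longleftrightarrow> odd N \<and> i = N - 1" for i
  define f :: "nat \<Rightarrow> nat" where "f i = (if l i then 3 else if even i then 0 else 1)" for i
  have "cyclic_coloring [1, 1, 3, k] N f"
  proof (rule cyclic_coloringI)
    fix i assume "i < N"
    show "f i < length [1, 1, 3, k]" by (simp add: f_def)
    show "[1, 1, 3, k] ! f i \<le> N \<or> (\<forall>j<N. j \<noteq> i \<longrightarrow> f j \<noteq> f i)"
      using assms by (auto simp: f_def l_def)
  next
    fix i d assume "i + d < N" "1 \<le> d" "d \<le> [1, 1, 3, k] ! f i"
    thus "f (i + d) \<noteq> f i" by (auto simp: f_def l_def split: if_splits)
  next
    fix i d assume *: "i < N" "N \<le> i + d" "d < N" "d \<le> [1, 1, 3, k] ! f i"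
    show "f (i + d - N) \<noteq> f i"
    proof (cases "l i")
      case True thus ?thesis using * by (auto simp: f_def l_def)
    next
      case False
      hence "d = 1" "i = N - 1" "even N" using * by (auto simp: f_def l_def split: if_splits)
      thus ?thesis using assms by (auto simp: f_def l_def)
    qed
  qed
  moreover have "f i \<noteq> 2" for i by (simp add: f_def)
  ultimately show ?thesis by blast
qed

lemma add_mod_neq:
  fixes i d m :: nat
  assumes "0 < d" "d < m"
  shows "(i + d) mod m \<noteq> i mod m"
proof
  assume "(i + d) mod m = i mod m"
  hence "m dvd (i + d) - i" by (metis mod_eq_dvd_iff_nat le_add1)
  thus False using assms by (simp add: nat_dvd_not_less)
qed

lemma mult_minus_mod:
  fixes m a d :: nat
  assumes "0 < a" "0 < d" "d \<le> m"
  shows "(m * a - d) mod m = m - d"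
proof -
  obtain c where "a = Suc c" using assms(1) gr0_implies_Suc by blast
  hence "m * a - d = m * c + (m - d)" using assms by simp
  thus ?thesis using assms by (simp only: mod_mult_self4) simp
qed

text \<open>Remainder 2 modulo 3 takes two blocks of length 4 and hence \<open>N \<ge> 8\<close>;
  from 3 on, this excludes only 5.\<close>

lemma block_decomposition:
  fixes N :: nat
  assumes "3 \<le> N" "N \<noteq> 5"
  shows "\<exists>a b. N = 3 * a + 4 * b"
proof -
  have "N mod 3 < 3" by simp
  then consider "N = 3 * (N div 3) + 4 * 0" | "N = 3 * (N div 3 - 1) + 4 * 1"
    | "N = 3 * (N div 3 - 2) + 4 * 2"
    using assms mult_div_mod_eq[of 3 N] by linarith
  thus ?thesis by (metis (no_types))
qed

text \<open>The words 012 and 0102 can be joined freely, also around the seam: each starts with 0,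
  has its only 1 at position 1 and its only 2 at the end. So equal nonzero letters are at least 3
  apart and no two zeros meet.\<close>

lemma cyclic_coloring_122:
  assumes "3 \<le> N" "N \<noteq> 5"
  shows "\<exists>f. cyclic_coloring [1, 2, 2, 3] N f \<and> (\<forall>i<N. f i \<noteq> 3)"
proof -
  obtain a b where N: "N = 3 * a + 4 * b" using block_decomposition[OF assms] by blast
  define g where "g i = (if even i then 0 else if i mod 4 = 1 then 1 else (2::nat))" for i :: nat
  define f where "f i = (if i < 3 * a then i mod 3 else g (i - 3 * a))" for i
  have v: "f i = 0 \<or> f i = 1 \<or> f i = 2" for i unfolding f_def g_def by auto
  have ns: "([1, 2, 2, 3] :: nat list) ! f i = (if f i = 0 then 1 else 2)" for i
    using v[of i] by auto
  have g1: "g (i + 1) \<noteq> g i" for i by (auto simp: g_def)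
  have g2: "g (i + 2) \<noteq> g i" if "g i \<noteq> 0" for i
  proof -
    have "odd i" using that by (auto simp: g_def)
    hence "(i + 2) mod 4 = 1 \<longleftrightarrow> i mod 4 \<noteq> 1" by presburger
    thus ?thesis using \<open>odd i\<close> by (auto simp: g_def)
  qed
  have "cyclic_coloring [1, 2, 2, 3] N f"
  proof (rule cyclic_coloringI)
    fix i assume "i < N"
    show "f i < length [1, 2, 2, 3]" using v[of i] by auto
    show "[1, 2, 2, 3] ! f i \<le> N \<or> (\<forall>j<N. j \<noteq> i \<longrightarrow> f j \<noteq> f i)"
      unfolding ns using assms by auto
  next
    fix i d assume *: "i + d < N" "1 \<le> d" "d \<le> [1, 2, 2, 3] ! f i"
    hence d: "d = 1 \<or> d = 2 \<and> f i \<noteq> 0" unfolding ns by (auto split: if_splits)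
    consider "i + d < 3 * a" | "i < 3 * a" "3 * a \<le> i + d" | "3 * a \<le> i" by linarith
    thus "f (i + d) \<noteq> f i"
    proof cases
      case 1
      have "(i + d) mod 3 \<noteq> i mod 3" using d by (intro add_mod_neq) auto
      thus ?thesis using 1 by (auto simp: f_def)
    next
      case 2
      hence "i = 3 * a - 1 \<and> (i + d - 3 * a = 0 \<or> i + d - 3 * a = 1) \<or>
          i = 3 * a - 2 \<and> i + d - 3 * a = 0"
        using d by linarith
      moreover have "(3 * a - 1) mod 3 = 2" "(3 * a - 2) mod 3 = 1"
        using 2 mult_minus_mod[of a 1 3] mult_minus_mod[of a 2 3] by auto
      moreover have "f i = i mod 3" "f (i + d) = g (i + d - 3 * a)" using 2 by (simp_all add: f_def)
      moreover have "g 0 = 0" "g 1 = 1" by (simp_all add: g_def)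
      ultimately show ?thesis by (metis n_not_Suc_n One_nat_def Suc_1 zero_neq_one zero_neq_numeral)
    next
      case 3
      hence "f (i + d) = g (i - 3 * a + d)" "f i = g (i - 3 * a)" by (simp_all add: f_def)
      thus ?thesis using d g1[of "i - 3 * a"] g2[of "i - 3 * a"] by metis
    qed
  next
    fix i d assume *: "i < N" "N \<le> i + d" "d < N" "d \<le> [1, 2, 2, 3] ! f i"
    hence d: "d = 1 \<or> d = 2 \<and> f i \<noteq> 0" unfolding ns by (auto split: if_splits)
    have j: "i = N - 1 \<and> (i + d - N = 0 \<or> i + d - N = 1) \<or> i = N - 2 \<and> i + d - N = 0 \<and> f i \<noteq> 0"
      using d * by auto
    have f01: "f 0 = 0" "f 1 = 1" by (cases "a = 0"; simp add: f_def g_def)+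
    have "f (N - 1) = 2"
    proof (cases "b = 0")
      case True
      hence "(N - 1) mod 3 = 2" using N assms mult_minus_mod[of a 1 3] by auto
      thus ?thesis using True N assms by (auto simp: f_def)
    next
      case False
      hence "odd (4 * b - 1)" "(4 * b - 1) mod 4 \<noteq> 1" using mult_minus_mod[of b 1 4] by auto
      moreover have "N - 1 - 3 * a = 4 * b - 1" using N by simp
      ultimately show ?thesis using False N by (auto simp: f_def g_def)
    qed
    thus "f (i + d - N) \<noteq> f i" using j f01 by auto
  qed
  moreover have "f i \<noteq> 3" for i using v[of i] by auto
  ultimately show ?thesis by blast
qed

text \<open>The words are 012 and 0123. Both carry the letter i at position i, so equal letters are
  at least one block length, hence 3, apart.\<close>

lemma cyclic_coloring_2222:
  assumes "3 \<le> N" "N \<noteq> 5"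
  shows "\<exists>f. cyclic_coloring [2, 2, 2, 2, 3] N f \<and> (\<forall>i<N. f i \<noteq> 4)"
proof -
  obtain a b where N: "N = 3 * a + 4 * b" using block_decomposition[OF assms] by blast
  define f where "f i = (if i < 3 * a then i mod 3 else (i - 3 * a) mod 4)" for i
  have v: "f i < 4" for i unfolding f_def by (auto intro: order_less_trans[of _ 3])
  have ns: "([2, 2, 2, 2, 3] :: nat list) ! f i = 2" for i
  proof -
    have "f i = 0 \<or> f i = 1 \<or> f i = 2 \<or> f i = 3" using v[of i] by linarith
    thus ?thesis by auto
  qed
  have "cyclic_coloring [2, 2, 2, 2, 3] N f"
  proof (rule cyclic_coloringI)
    fix i assume "i < N"
    show "f i < length [2, 2, 2, 2, 3]" using v[of i] by simp
    show "[2, 2, 2, 2, 3] ! f i \<le> N \<or> (\<forall>j<N. j \<noteq> i \<longrightarrow> f j \<noteq> f i)"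
      unfolding ns using assms by auto
  next
    fix i d assume *: "i + d < N" "1 \<le> d" "d \<le> [2, 2, 2, 2, 3] ! f i"
    hence d: "d = 1 \<or> d = 2" unfolding ns by auto
    consider "i + d < 3 * a" | "i < 3 * a" "3 * a \<le> i + d" | "3 * a \<le> i" by linarith
    thus "f (i + d) \<noteq> f i"
    proof cases
      case 1
      have "(i + d) mod 3 \<noteq> i mod 3" using d by (intro add_mod_neq) auto
      thus ?thesis using 1 by (auto simp: f_def)
    next
      case 2
      hence "i = 3 * a - 1 \<and> (i + d - 3 * a = 0 \<or> i + d - 3 * a = 1) \<or>
          i = 3 * a - 2 \<and> i + d - 3 * a = 0"
        using d by linarith
      moreover have "(3 * a - 1) mod 3 = 2" "(3 * a - 2) mod 3 = 1"
        using 2 mult_minus_mod[of a 1 3] mult_minus_mod[of a 2 3] by auto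
      moreover have "f i = i mod 3" "f (i + d) = (i + d - 3 * a) mod 4" using 2 by (simp_all add: f_def)
      ultimately show ?thesis by (elim disjE conjE) (simp_all)
    next
      case 3
      have "(i - 3 * a + d) mod 4 \<noteq> (i - 3 * a) mod 4" using d by (intro add_mod_neq) auto
      thus ?thesis using 3 by (auto simp: f_def)
    qed
  next
    fix i d assume *: "i < N" "N \<le> i + d" "d < N" "d \<le> [2, 2, 2, 2, 3] ! f i"
    hence "d = 1 \<or> d = 2" unfolding ns by auto
    hence j: "i = N - 1 \<and> (i + d - N = 0 \<or> i + d - N = 1) \<or> i = N - 2 \<and> i + d - N = 0"
      using * by auto
    have f01: "f 0 = 0" "f 1 = 1" by (cases "a = 0"; simp add: f_def)+
    have "f (N - 1) \<ge> 2 \<and> f (N - 2) \<ge> 1"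
    proof (cases "b = 0")
      case True
      hence "(N - 1) mod 3 = 2" "(N - 2) mod 3 = 1"
        using N assms mult_minus_mod[of a 1 3] mult_minus_mod[of a 2 3] by auto
      thus ?thesis using True N assms by (auto simp: f_def)
    next
      case False
      hence "(4 * b - 1) mod 4 = 3" "(4 * b - 2) mod 4 = 2"
        using mult_minus_mod[of b 1 4] mult_minus_mod[of b 2 4] by auto
      moreover have "N - 1 - 3 * a = 4 * b - 1" "N - 2 - 3 * a = 4 * b - 2"
        "\<not> N - 1 < 3 * a" "\<not> N - 2 < 3 * a" using N False by auto
      ultimately show ?thesis by (auto simp: f_def)
    qed
    thus "f (i + d - N) \<noteq> f i" using j f01 by auto
  qed
  moreover have "f i \<noteq> 4" for i using v[of i] by auto
  ultimately show ?thesis by blast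
qed

text \<open>The pattern is 01030104 with period 8; if 8 does not divide \<open>N\<close>, the last
  position takes the colour of value \<open>k\<close>. The seam is safe because a periodic colour of
  value s first occurs at position s - 1 or later, so across the replaced position two occurrences
  are at least s + 1 apart.\<close>

lemma cyclic_coloring_1245k:
  assumes "3 \<le> N"
  shows "\<exists>f. cyclic_coloring [1, 2, 3, 4, 5, k] N f \<and> (\<forall>i<N. f i \<noteq> 2)"
proof -
  define l where "l i \<longleftrightarrow> i = N - 1 \<and> N mod 8 \<noteq> 0" for i
  define f :: "nat \<Rightarrow> nat" where
    "f i = (if l i then 5 else if even i then 0 else if i mod 4 = 1 then 1
      else if i mod 8 = 3 then 3 else 4)" for i
  have m7: "i mod 8 = 7 \<longleftrightarrow> odd i \<and> i mod 4 \<noteq> 1 \<and> i mod 8 \<noteq> 3" for i :: nat by presburger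
  have m3: "odd i \<and> i mod 4 \<noteq> 1" if "i mod 8 = 3" for i :: nat using that by presburger
  have m1: "odd i" if "i mod 4 = 1" for i :: nat using that by presburger
  have f0: "f i = 0 \<longleftrightarrow> \<not> l i \<and> even i" and f1: "f i = 1 \<longleftrightarrow> \<not> l i \<and> i mod 4 = 1"
    and f3: "f i = 3 \<longleftrightarrow> \<not> l i \<and> i mod 8 = 3" and f4: "f i = 4 \<longleftrightarrow> \<not> l i \<and> i mod 8 = 7"
    and f5: "f i = 5 \<longleftrightarrow> l i"
    for i using m7[of i] m3[of i] m1[of i] by (auto simp: f_def)
  have v: "f i = 0 \<or> f i = 1 \<or> f i = 3 \<or> f i = 4 \<or> f i = 5" for i unfolding f_def by auto
  have ns: "([1, 2, 3, 4, 5, k] :: nat list) ! f i = (if f i = 5 then k else f i + 1)" for i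
    using v[of i] by auto
  have "cyclic_coloring [1, 2, 3, 4, 5, k] N f"
  proof (rule cyclic_coloringI)
    fix i assume i: "i < N"
    show "f i < length [1, 2, 3, 4, 5, k]" using v[of i] by auto
    have "N \<ge> 4" if "f i = 3"
    proof -
      have "i mod 8 = 3" using that f3 by auto
      hence "i \<ge> 3" by presburger
      thus ?thesis using i by simp
    qed
    moreover have "N \<ge> 8" if "f i = 4"
    proof -
      have "i mod 8 = 7" using that f4 by auto
      hence "i \<ge> 7" by presburger
      thus ?thesis using i by simp
    qed
    moreover have "\<forall>j<N. j \<noteq> i \<longrightarrow> f j \<noteq> f i" if "f i = 5"
      using that f5 l_def by metis
    ultimately show "[1, 2, 3, 4, 5, k] ! f i \<le> N \<or> (\<forall>j<N. j \<noteq> i \<longrightarrow> f j \<noteq> f i)"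
      unfolding ns using v[of i] assms by (elim disjE) simp_all
  next
    fix i d assume *: "i + d < N" "1 \<le> d" "d \<le> [1, 2, 3, 4, 5, k] ! f i"
    have "\<not> l i" using * by (auto simp: l_def)
    hence "d \<le> f i + 1" using *(3) f5[of i] unfolding ns by simp
    then consider "f i = 0" "d = 1" | "f i = 1" "1 \<le> d \<and> d \<le> 2" | "f i = 3" "1 \<le> d \<and> d \<le> 4"
      | "f i = 4" "1 \<le> d \<and> d \<le> 5"
      using v[of i] f5[of i] \<open>\<not> l i\<close> *(2) by force
    thus "f (i + d) \<noteq> f i"
    proof cases
      case 1 thus ?thesis using f0[of i] f0[of "i + d"] by auto
    next
      case 2
      hence "i mod 4 = 1" using f1[of i] by metis
      moreover have "(i + d) mod 4 \<noteq> i mod 4" using 2(2) by (intro add_mod_neq) auto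
      ultimately show ?thesis using 2(1) f1[of "i + d"] by metis
    next
      case 3
      hence "i mod 8 = 3" using f3[of i] by metis
      moreover have "(i + d) mod 8 \<noteq> i mod 8" using 3(2) by (intro add_mod_neq) auto
      ultimately show ?thesis using 3(1) f3[of "i + d"] by metis
    next
      case 4
      hence "i mod 8 = 7" using f4[of i] by metis
      moreover have "(i + d) mod 8 \<noteq> i mod 8" using 4(2) by (intro add_mod_neq) auto
      ultimately show ?thesis using 4(1) f4[of "i + d"] by metis
    qed
  next
    fix i d assume *: "i < N" "N \<le> i + d" "d < N" "d \<le> [1, 2, 3, 4, 5, k] ! f i"
    show "f (i + d - N) \<noteq> f i"
    proof (cases "l i")
      case True
      hence "i = N - 1" "i + d - N \<noteq> N - 1" using * by (auto simp: l_def)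
      thus ?thesis using True f5[of i] f5[of "i + d - N"] l_def by metis
    next
      case False
      hence d: "d \<le> f i + 1" using *(4) f5[of i] unfolding ns by simp
      obtain j where j: "j = i + d - N" "i + d = N + j" using *(2) le_add_diff_inverse by metis
      have jd: "j < d" using j * by simp
      \<comment> \<open>A last position that keeps its periodic colour means that the pattern closes
        up exactly.\<close>
      have l: "N = i + 1 \<longrightarrow> N mod 8 = 0" using False l_def by (metis add_diff_cancel_right')
      consider "f i = 0" | "f i = 1" | "f i = 3" | "f i = 4" using v[of i] f5[of i] False by metis
      hence "f j \<noteq> f i"
      proof cases
        case 1
        hence "even i" "N = i + 1" using f0[of i] d * by simp_all
        moreover from this l have "(i + 1) mod 8 = 0" by simp
        ultimately show ?thesis by presburger
      next
        case 2
        hence i: "i mod 4 = 1" and "d \<le> 2" using f1[of i] d by simp_all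
        have "j \<noteq> 1"
        proof
          assume "j = 1"
          hence "N = i + 1" using \<open>d \<le> 2\<close> \<open>j = 1\<close> j(2) *(1) by linarith
          hence "(i + 1) mod 8 = 0" using l by simp
          thus False using i by presburger
        qed
        hence "j = 0" using jd \<open>d \<le> 2\<close> by linarith
        thus ?thesis using f1[of j] 2 by simp
      next
        case 3
        hence i: "i mod 8 = 3" and "d \<le> 4" using f3[of i] d by simp_all
        have "j \<noteq> 3"
        proof
          assume "j = 3"
          hence "N = i + 1" using \<open>d \<le> 4\<close> \<open>j = 3\<close> j(2) *(1) by linarith
          hence "(i + 1) mod 8 = 0" using l by simp
          thus False using i by presburger
        qed
        hence "j < 3" using jd \<open>d \<le> 4\<close> by linarith
        thus ?thesis using f3[of j] 3 by simp
      next
        case 4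
        hence "j < 5" using jd d by linarith
        thus ?thesis using f4[of j] 4 by simp
      qed
      thus ?thesis using j(1) by metis
    qed
  qed
  moreover have "f i \<noteq> 2" for i using v[of i] by auto
  ultimately show ?thesis by blast
qed

section \<open>Packing colourings on closed vertex sets\<close>

locale subcubic_relation =
  fixes adj :: "'a \<Rightarrow> 'a \<Rightarrow> bool"
  assumes adj_sym: "adj u w \<Longrightarrow> adj w u"
    and adj_irrefl: "\<not> adj u u"
    and finite_nbs: "finite {w. adj u w}"
    and card_nbs: "card {w. adj u w} \<le> 3"
begin

definition nbs :: "'a \<Rightarrow> 'a set" where
  "nbs u = {w. adj u w}"

text \<open>This is the relation of being at distance at most \<open>s\<close>, phrased by walks so
  that infinite distances need no separate treatment.\<close>

primrec near :: "nat \<Rightarrow> 'a \<Rightarrow> 'a \<Rightarrow> bool" where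
  "near 0 u w \<longleftrightarrow> u = w"
| "near (Suc s) u w \<longleftrightarrow> near s u w \<or> (\<exists>x. adj u x \<and> near s x w)"

definition adj_closed :: "'a set \<Rightarrow> bool" where
  "adj_closed Z \<longleftrightarrow> (\<forall>u\<in>Z. nbs u \<subseteq> Z)"

text \<open>Nearness is measured in the whole relation; for closed \<open>Z\<close> this agrees with
  nearness inside \<open>Z\<close>, because no walk leaves \<open>Z\<close>.\<close>

definition pack_colorable_on :: "nat list \<Rightarrow> 'a set \<Rightarrow> bool" where
  "pack_colorable_on S Z \<longleftrightarrow> (\<exists>c. \<forall>u\<in>Z. c u < length S \<and>
     (\<forall>w\<in>Z. u \<noteq> w \<longrightarrow> c u = c w \<longrightarrow> \<not> near (S ! c u) u w))"

lemma in_nbs [simp]: "w \<in> nbs u \<longleftrightarrow> adj u w"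
  by (simp add: nbs_def)

lemma finite_nbs' [simp]: "finite (nbs u)"
  using finite_nbs by (simp add: nbs_def)

lemma near_mono: "s \<le> t \<Longrightarrow> near s u w \<Longrightarrow> near t u w"
  by (induction rule: dec_induct) auto

lemma near_snoc: "near s u x \<Longrightarrow> adj x w \<Longrightarrow> near (Suc s) u w"
  by (induction s arbitrary: u) auto

lemma near_sym: "near s u w \<Longrightarrow> near s w u"
proof (induction s arbitrary: u)
  case (Suc s)
  thus ?case using near_snoc adj_sym by (metis near.simps(2))
qed auto

lemma near_one_iff: "near 1 u w \<longleftrightarrow> u = w \<or> adj u w"
  by auto

lemma adj_closedD: "adj_closed Z \<Longrightarrow> u \<in> Z \<Longrightarrow> adj u w \<Longrightarrow> w \<in> Z"
  by (auto simp: adj_closed_def subset_iff)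

lemma near_two_iff: "near 2 u w \<longleftrightarrow> u = w \<or> adj u w \<or> (\<exists>x. adj u x \<and> adj x w)"
  by (auto simp: numeral_2_eq_2)

lemma near_3I: "adj u x \<Longrightarrow> x = y \<or> adj x y \<Longrightarrow> adj y w \<Longrightarrow> near 3 u w"
  by (auto simp: numeral_3_eq_3)

lemma near_in_closed: "adj_closed Z \<Longrightarrow> near s u w \<Longrightarrow> u \<in> Z \<Longrightarrow> w \<in> Z"
  by (induction s arbitrary: u) (auto dest: adj_closedD)

lemma adj_closed_Diff:
  assumes "adj_closed X" "adj_closed Z"
  shows "adj_closed (X - Z)"
  using assms adj_sym by (fastforce simp: adj_closed_def)

lemma pack_colorable_on_Un:
  assumes "adj_closed Y" "adj_closed Z" "Y \<inter> Z = {}"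
    and "pack_colorable_on S Y" "pack_colorable_on S Z"
  shows "pack_colorable_on S (Y \<union> Z)"
proof -
  obtain c where c: "\<forall>u\<in>Y. c u < length S \<and>
     (\<forall>w\<in>Y. u \<noteq> w \<longrightarrow> c u = c w \<longrightarrow> \<not> near (S ! c u) u w)"
    using assms(4) unfolding pack_colorable_on_def by blast
  obtain d where d: "\<forall>u\<in>Z. d u < length S \<and>
     (\<forall>w\<in>Z. u \<noteq> w \<longrightarrow> d u = d w \<longrightarrow> \<not> near (S ! d u) u w)"
    using assms(5) unfolding pack_colorable_on_def by blast
  have "\<not> near s u w" if "u \<in> Y" "w \<in> Z" for s u w
    using that near_in_closed[OF assms(1), of s u w] assms(3) by blast
  moreover have "\<not> near s u w" if "u \<in> Z" "w \<in> Y" for s u w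
    using that near_in_closed[OF assms(2), of s u w] assms(3) by blast
  moreover have "u \<notin> Y" if "u \<in> Z" for u using that assms(3) by blast
  ultimately show ?thesis unfolding pack_colorable_on_def
    using c d by (intro exI[of _ "\<lambda>u. if u \<in> Y then c u else d u"]) auto
qed

text \<open>Disjoint closed sets are infinitely far apart, so they can be coloured independently and
  peeled off one by one. The hypothesis ranges over all closed \<open>Y\<close> because the
  remainder after a step is only known to be closed.\<close>

lemma pack_colorable_on_pieces:
  assumes "finite X" "adj_closed X"
    and "\<And>Y. Y \<subseteq> X \<Longrightarrow> adj_closed Y \<Longrightarrow> Y \<noteq> {} \<Longrightarrow>
      \<exists>Z\<subseteq>Y. Z \<noteq> {} \<and> adj_closed Z \<and> pack_colorable_on S Z"
  shows "pack_colorable_on S X"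
  using assms
proof (induction "card X" arbitrary: X rule: less_induct)
  case less
  show ?case
  proof (cases "X = {}")
    case True thus ?thesis by (simp add: pack_colorable_on_def)
  next
    case False
    then obtain Z where Z: "Z \<subseteq> X" "Z \<noteq> {}" "adj_closed Z" "pack_colorable_on S Z"
      using less.prems by blast
    have "card (X - Z) < card X"
      using Z less.prems(1) by (intro psubset_card_mono) auto
    moreover have "adj_closed (X - Z)" using less.prems(2) Z(3) by (rule adj_closed_Diff)
    moreover have "\<exists>Z'\<subseteq>Y. Z' \<noteq> {} \<and> adj_closed Z' \<and> pack_colorable_on S Z'"
      if "Y \<subseteq> X - Z" "adj_closed Y" "Y \<noteq> {}" for Y
      using less.prems(3)[of Y] that by blast
    ultimately have "pack_colorable_on S (X - Z)"
      using less.prems(1) by (intro less.hyps) auto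
    hence "pack_colorable_on S (Z \<union> (X - Z))"
      using Z less.prems adj_closed_Diff by (intro pack_colorable_on_Un) auto
    moreover have "Z \<union> (X - Z) = X" using Z by blast
    ultimately show ?thesis by simp
  qed
qed

text \<open>Along a walk the changes of size at most 1 add up. This bound takes the place of a
  computation of distances in the core.\<close>

lemma near_weak_hom:
  fixes \<phi> :: "'a \<Rightarrow> int"
  assumes "adj_closed Z"
    and "\<And>u w. u \<in> Z \<Longrightarrow> adj u w \<Longrightarrow> \<exists>d. \<bar>d\<bar> \<le> 1 \<and> N dvd \<phi> w - \<phi> u - d"
  shows "near s u w \<Longrightarrow> u \<in> Z \<Longrightarrow> \<exists>d. \<bar>d\<bar> \<le> int s \<and> N dvd \<phi> w - \<phi> u - d"
proof (induction s arbitrary: u)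
  case 0
  thus ?case by auto
next
  case (Suc s)
  show ?case
  proof (cases "near s u w")
    case True
    thus ?thesis using Suc.IH[of u] Suc.prems by force
  next
    case False
    then obtain x where x: "adj u x" "near s x w" using Suc.prems by auto
    have "x \<in> Z" using x(1) Suc.prems assms(1) adj_closedD by blast
    then obtain d where d: "\<bar>d\<bar> \<le> int s" "N dvd \<phi> w - \<phi> x - d" using Suc.IH[OF x(2)] by blast
    obtain e where e: "\<bar>e\<bar> \<le> 1" "N dvd \<phi> x - \<phi> u - e"
      using assms(2)[OF Suc.prems(2) x(1)] by blast
    have "N dvd (\<phi> w - \<phi> x - d) + (\<phi> x - \<phi> u - e)" using d e by (intro dvd_add)
    hence "N dvd \<phi> w - \<phi> u - (d + e)" by (simp add: algebra_simps)
    moreover have "\<bar>d + e\<bar> \<le> int (Suc s)" using d e by simp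
    ultimately show ?thesis by blast
  qed
qed

text \<open>The periodic colouring is pulled back along \<open>\<phi>\<close>: near core vertices of
  equal colour would give equal colours at positions that are too close, and injectivity makes these
  positions differ. Colour \<open>j\<close> is reserved for \<open>E\<close>.\<close>

lemma pack_colorable_on_cyclic:
  assumes Z: "adj_closed Z"
    and hom: "\<And>u w. u \<in> Z \<Longrightarrow> adj u w \<Longrightarrow> \<exists>d. \<bar>d\<bar> \<le> 1 \<and> int N dvd int (\<phi> w) - int (\<phi> u) - d"
    and lt: "\<And>u. u \<in> Z \<Longrightarrow> \<phi> u < N"
    and inj: "inj_on \<phi> (Z - E)"
    and E: "\<And>u w. u \<in> E \<Longrightarrow> w \<in> E \<Longrightarrow> u \<noteq> w \<Longrightarrow> \<not> near 3 u w"
    and f: "cyclic_coloring S N f" "\<forall>i<N. f i \<noteq> j" "j < length S" "S ! j \<le> 3"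
  shows "pack_colorable_on S Z"
proof -
  define c where "c u = (if u \<in> E then j else f (\<phi> u))" for u
  \<comment> \<open>Only forward steps are treated; a negative difference is reversed below by
    exchanging the two vertices, which have the same colour and hence the same value.\<close>
  have step: False if uw: "u \<in> Z - E" "w \<in> Z - E" "u \<noteq> w" "f (\<phi> u) = f (\<phi> w)"
    and d: "0 \<le> d" "d \<le> int (S ! f (\<phi> u))" "int N dvd int (\<phi> w) - int (\<phi> u) - d" for u w d
  proof -
    have lts: "\<phi> u < N" "\<phi> w < N" using uw lt by auto
    have "int (\<phi> w) mod int N = int (\<phi> u + nat d) mod int N"
      using d by (simp add: mod_eq_dvd_iff algebra_simps)
    hence w: "\<phi> w = (\<phi> u + nat d) mod N" using lts
      by (metis mod_less of_nat_eq_iff of_nat_mod)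
    have "\<phi> u \<noteq> \<phi> w" using inj uw by (auto simp: inj_on_def)
    hence "\<not> N dvd nat d" using w lts by (metis mod_add_right_eq dvd_imp_mod_0 add_0_right mod_less)
    moreover from this have "1 \<le> nat d" by (cases "nat d") auto
    moreover have "nat d \<le> S ! f (\<phi> u)" using d by simp
    ultimately show False using f(1) lts w uw(4) unfolding cyclic_coloring_def by metis
  qed
  have core: "\<not> near (S ! f (\<phi> u)) u w"
    if uw: "u \<in> Z - E" "w \<in> Z - E" "u \<noteq> w" "f (\<phi> u) = f (\<phi> w)" for u w
  proof
    assume "near (S ! f (\<phi> u)) u w"
    then obtain d where d: "\<bar>d\<bar> \<le> int (S ! f (\<phi> u))" "int N dvd int (\<phi> w) - int (\<phi> u) - d"
      using near_weak_hom[OF Z, of "int N" "\<lambda>u. int (\<phi> u)"] hom uw(1) by blast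
    show False
    proof (cases "0 \<le> d")
      case True thus ?thesis using step[OF uw, of d] d by auto
    next
      case False
      have "int N dvd - (int (\<phi> w) - int (\<phi> u) - d)" using d(2) by (simp only: dvd_minus_iff)
      hence "int N dvd int (\<phi> u) - int (\<phi> w) - (- d)" by (simp add: algebra_simps)
      thus ?thesis using step[of w u "- d"] uw d False by auto
    qed
  qed
  have "c u < length S \<and> (\<forall>w\<in>Z. u \<noteq> w \<longrightarrow> c u = c w \<longrightarrow> \<not> near (S ! c u) u w)" if "u \<in> Z" for u
  proof (cases "u \<in> E")
    case True
    have "\<not> near (S ! j) u w" if "w \<in> E" "u \<noteq> w" for w
      using E[OF True that] near_mono[OF f(4)] by blast
    thus ?thesis using True f(2,3) lt by (auto simp: c_def)
  next
    case False
    have "f (\<phi> u) < length S" using f(1) lt[OF that] by (auto simp: cyclic_coloring_def)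
    thus ?thesis using False f(2) lt[OF that] core[of u] that by (auto simp: c_def)
  qed
  thus ?thesis unfolding pack_colorable_on_def by blast
qed

section \<open>Graphs of maximum degree 2\<close>

definition simple_path :: "'a list \<Rightarrow> bool" where
  "simple_path p \<longleftrightarrow> distinct p \<and> (\<forall>i. Suc i < length p \<longrightarrow> adj (p ! i) (p ! Suc i))"

lemma simple_path_Cons:
  assumes "simple_path p" "w \<notin> set p" "p \<noteq> []" "adj (p ! 0) w"
  shows "simple_path (w # p)"
  unfolding simple_path_def
proof (intro conjI allI impI)
  show "distinct (w # p)" using assms by (simp add: simple_path_def)
  fix i assume "Suc i < length (w # p)"
  thus "adj ((w # p) ! i) ((w # p) ! Suc i)"
    using assms adj_sym by (cases i) (auto simp: simple_path_def)
qed

lemma simple_path_rev: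
  assumes "simple_path p"
  shows "simple_path (rev p)"
  unfolding simple_path_def
proof (intro conjI allI impI)
  show "distinct (rev p)" using assms by (simp add: simple_path_def)
  fix i assume i: "Suc i < length (rev p)"
  define k where "k = length p - Suc (Suc i)"
  have "adj (p ! k) (p ! Suc k)" using assms i by (auto simp: simple_path_def k_def)
  moreover have "rev p ! i = p ! Suc k" "rev p ! Suc i = p ! k"
    using i by (auto simp: rev_nth k_def Suc_diff_Suc)
  ultimately show "adj (rev p ! i) (rev p ! Suc i)" using adj_sym by simp
qed

lemma simple_path_interior:
  assumes p: "simple_path p" "set p \<subseteq> C" and C: "\<And>v. v \<in> C \<Longrightarrow> card (nbs v \<inter> C) \<le> 2"
    and i: "Suc (Suc i) < length p"
  shows "nbs (p ! Suc i) \<inter> C = {p ! i, p ! Suc (Suc i)}"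
proof -
  have "adj (p ! Suc i) (p ! Suc (Suc i))" using p i by (simp add: simple_path_def)
  moreover have "adj (p ! Suc i) (p ! i)" using p i adj_sym by (simp add: simple_path_def)
  moreover have ne: "p ! i \<noteq> p ! Suc (Suc i)"
    using p i by (simp add: simple_path_def nth_eq_iff_index_eq)
  moreover have mem: "p ! k \<in> C" if "k \<le> Suc (Suc i)" for k
    using p(2) i that nth_mem[of k p] by auto
  ultimately have "{p ! i, p ! Suc (Suc i)} \<subseteq> nbs (p ! Suc i) \<inter> C" by auto
  moreover have "card {p ! i, p ! Suc (Suc i)} = 2" using ne by simp
  moreover have "finite (nbs (p ! Suc i) \<inter> C)" by simp
  moreover have "card (nbs (p ! Suc i) \<inter> C) \<le> 2" using C mem by simp
  ultimately show ?thesis by (metis card_seteq)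
qed

text \<open>By maximality every neighbour of the end lies on the path. An inner vertex already has
  both its neighbours in \<open>C\<close> on the path, so only the second vertex and the other end
  remain.\<close>

lemma longest_path_end:
  assumes p: "simple_path p" "set p \<subseteq> C" "p \<noteq> []"
    and C: "\<And>v. v \<in> C \<Longrightarrow> card (nbs v \<inter> C) \<le> 2"
    and max: "\<And>q. simple_path q \<Longrightarrow> set q \<subseteq> C \<Longrightarrow> length q \<le> length p"
    and w: "w \<in> C" "adj (p ! 0) w"
  shows "\<exists>j<length p. w = p ! j \<and> (j = 1 \<or> j = length p - 1)"
proof -
  have "w \<in> set p"
  proof (rule ccontr)
    assume "w \<notin> set p"
    hence "simple_path (w # p)" using simple_path_Cons p w by blast
    hence "length (w # p) \<le> length p" using max[of "w # p"] p w by simp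
    thus False by simp
  qed
  then obtain j where j: "j < length p" "w = p ! j" by (auto simp: in_set_conv_nth)
  have "j \<noteq> 0" using w j adj_irrefl by metis
  have "p ! 0 \<in> C" using p nth_mem[of 0 p] by auto
  have "j = 1" if "j \<noteq> length p - 1"
  proof -
    obtain k where k: "j = Suc k" using \<open>j \<noteq> 0\<close> not0_implies_Suc by blast
    have lt: "Suc (Suc k) < length p" using j that k by simp
    have "nbs (p ! j) \<inter> C = {p ! k, p ! Suc (Suc k)}"
      unfolding k using p C lt by (intro simple_path_interior) auto
    moreover have "p ! 0 \<in> nbs (p ! j) \<inter> C" using w j adj_sym \<open>p ! 0 \<in> C\<close> by simp
    ultimately have "p ! 0 = p ! k \<or> p ! 0 = p ! Suc (Suc k)" by auto
    moreover have "distinct p" "0 < length p" "k < length p" using p lt by (auto simp: simple_path_def)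
    ultimately have "k = 0" using lt by (metis nth_eq_iff_index_eq nat.distinct(1))
    thus ?thesis using k by simp
  qed
  thus ?thesis using j by blast
qed

text \<open>With maximum degree 2, a longest path already spans a connected component of the graph
  on \<open>C\<close>, and the only possible further edge joins its ends.\<close>

lemma closed_path:
  assumes "finite C" "C \<noteq> {}" and C: "\<And>v. v \<in> C \<Longrightarrow> card (nbs v \<inter> C) \<le> 2"
  obtains p where "p \<noteq> []" "simple_path p" "set p \<subseteq> C"
    "\<And>i w. i < length p \<Longrightarrow> w \<in> C \<Longrightarrow> adj (p ! i) w \<Longrightarrow> \<exists>j<length p. w = p ! j \<and>
       (j = Suc i \<or> i = Suc j \<or> i = 0 \<and> j = length p - 1 \<or> j = 0 \<and> i = length p - 1)"
proof -
  let ?P = "\<lambda>q. simple_path q \<and> set q \<subseteq> C"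
  have bound: "length q \<le> card C" if "?P q" for q
    using that assms(1) by (metis simple_path_def distinct_card card_mono)
  have "?P []" by (simp add: simple_path_def)
  then obtain p where p: "?P p" and max: "\<And>q. ?P q \<Longrightarrow> length q \<le> length p"
    using ex_has_greatest_nat[of ?P "[]" length "Suc (card C)"] bound le_imp_less_Suc by (metis (no_types, lifting))
  obtain x where "x \<in> C" using assms(2) by blast
  hence "?P [x]" by (simp add: simple_path_def)
  hence ne: "p \<noteq> []" using max[of "[x]"] by auto
  have "\<exists>j<length p. w = p ! j \<and>
       (j = Suc i \<or> i = Suc j \<or> i = 0 \<and> j = length p - 1 \<or> j = 0 \<and> i = length p - 1)"
    if i: "i < length p" and w: "w \<in> C" "adj (p ! i) w" for i w
  proof -
    consider "i = 0" | "i = length p - 1" | "0 < i" "Suc i < length p" using i by linarith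
    thus ?thesis
    proof cases
      case 1
      thus ?thesis using longest_path_end[of p C w] p ne C max w by auto
    next
      case 2
      have "rev p ! 0 = p ! i" using 2 ne by (simp add: rev_nth)
      hence "\<exists>j<length (rev p). w = rev p ! j \<and> (j = 1 \<or> j = length (rev p) - 1)"
        using p ne C max w by (intro longest_path_end[of "rev p" C w] simple_path_rev) auto
      then obtain j where j: "j < length p" "w = rev p ! j" "j = 1 \<or> j = length p - 1" by auto
      hence "w = p ! (length p - Suc j)" by (simp add: rev_nth)
      moreover have "length p - Suc j < length p" using j by simp
      ultimately show ?thesis using j 2 by (intro exI[of _ "length p - Suc j"]) auto
    next
      case 3
      then obtain k where k: "i = Suc k" using gr0_implies_Suc by blast
      have "nbs (p ! i) \<inter> C = {p ! k, p ! Suc (Suc k)}"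
        unfolding k using p C 3 k by (intro simple_path_interior) auto
      hence "w \<in> {p ! k, p ! Suc i}" using w k by (metis IntI in_nbs)
      moreover have "k < length p" using 3 k by simp
      ultimately show ?thesis using 3(2) k by (metis insertE singletonD)
    qed
  qed
  thus ?thesis using that[of p] p ne by blast
qed

section \<open>Retraction onto a core of maximum degree 2\<close>

lemma maximal_separated_subset:
  assumes "finite Q"
  obtains E where "E \<subseteq> Q" "\<And>u w. u \<in> E \<Longrightarrow> w \<in> E \<Longrightarrow> u \<noteq> w \<Longrightarrow> \<not> near 3 u w"
    "\<And>q. q \<in> Q - E \<Longrightarrow> \<exists>e\<in>E. near 3 q e"
proof -
  let ?F = "{F. F \<subseteq> Q \<and> (\<forall>u\<in>F. \<forall>w\<in>F. u \<noteq> w \<longrightarrow> \<not> near 3 u w)}"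
  have "finite ?F" using assms by (intro finite_subset[of ?F "Pow Q"]) auto
  moreover have "{} \<in> ?F" by simp
  ultimately obtain E where E: "E \<in> ?F" and max: "\<And>F. F \<in> ?F \<Longrightarrow> E \<subseteq> F \<Longrightarrow> E = F"
    using finite_has_maximal[of ?F] by (metis (no_types, lifting) empty_iff)
  have "\<exists>e\<in>E. near 3 q e" if "q \<in> Q - E" for q
  proof (rule ccontr)
    assume c: "\<not> ?thesis"
    hence "\<not> near 3 e q" if "e \<in> E" for e using near_sym that by blast
    hence "insert q E \<in> ?F" using E that c by auto
    hence "E = insert q E" by (intro max) auto
    thus False using that by blast
  qed
  thus ?thesis using that[of E] E by blast
qed

text \<open>\<open>Q\<close> holds the candidates for deletion, and \<open>sep\<close> is the
  exchange property that lets a maximal separated subset of \<open>Q\<close> inherit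
  \<open>hit\<close>. The piece \<open>Z\<close> is the preimage of one component of the core under
  the retraction. The last conclusion confines the exceptional length 5 to genuine 5-cycles.\<close>

lemma closed_piece:
  assumes X: "finite X" "adj_closed X" "X \<noteq> {}"
    and Q: "Q \<subseteq> X" "\<And>q. q \<in> Q \<Longrightarrow> \<exists>r. r \<noteq> q \<and> (\<forall>x. adj q x \<longrightarrow> x = r \<or> adj x r)"
      "\<And>q. q \<in> Q \<Longrightarrow> nbs q \<noteq> {}"
    and hit: "\<And>v. v \<in> X \<Longrightarrow> card (nbs v) = 3 \<Longrightarrow> \<exists>q\<in>Q. adj v q"
    and sep: "\<And>q e v. q \<in> Q \<Longrightarrow> e \<in> Q \<Longrightarrow> q \<noteq> e \<Longrightarrow> near 3 q e \<Longrightarrow> card (nbs v) = 3 \<Longrightarrow>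
      adj v q \<Longrightarrow> adj v e"
  obtains Z E N \<phi> p where
    "Z \<subseteq> X" "Z \<noteq> {}" "adj_closed Z" "3 \<le> N"
    "\<And>u w. u \<in> Z \<Longrightarrow> adj u w \<Longrightarrow> \<exists>d. \<bar>d\<bar> \<le> 1 \<and> int N dvd int (\<phi> w) - int (\<phi> u) - d"
    "\<And>u. u \<in> Z \<Longrightarrow> \<phi> u < N" "inj_on \<phi> (Z - E)"
    "\<And>u w. u \<in> E \<Longrightarrow> w \<in> E \<Longrightarrow> u \<noteq> w \<Longrightarrow> \<not> near 3 u w"
    "E \<subseteq> Q" "Z - E = set p" "simple_path p"
    "\<And>i j. i < length p \<Longrightarrow> j < length p \<Longrightarrow> adj (p ! i) (p ! j) \<Longrightarrow>
       j = Suc i \<or> i = Suc j \<or> i = 0 \<and> j = length p - 1 \<or> j = 0 \<and> i = length p - 1"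
    "N = 5 \<Longrightarrow> length p = 5 \<and> adj (p ! 0) (p ! 4)"
proof -
  obtain E where EQ: "E \<subseteq> Q" and E: "\<And>u w. u \<in> E \<Longrightarrow> w \<in> E \<Longrightarrow> u \<noteq> w \<Longrightarrow> \<not> near 3 u w"
    and max: "\<And>q. q \<in> Q - E \<Longrightarrow> \<exists>e\<in>E. near 3 q e"
    using maximal_separated_subset[of Q] X(1) Q(1) finite_subset by metis
  have far: "e \<notin> E" if "e' \<in> E" "e' \<noteq> e" "near 2 e' e" for e e'
    using E[OF that(1) _ that(2)] near_mono[OF _ that(3), of 3] by auto
  have near2: "near 2 u w" if "adj u w" for u w
    using that near_mono[of 1 2 u w] near_one_iff by simp
  have near2': "near 2 u w" if "adj u x" "adj x w" for u x w
    using that near_snoc[of 1 u x w] near_one_iff[of u x] by (simp add: numeral_2_eq_2)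
  have hitE: "\<exists>e\<in>E. adj v e" if v: "v \<in> X" "card (nbs v) = 3" for v
  proof -
    obtain q where q: "q \<in> Q" "adj v q" using hit[OF v] by blast
    show ?thesis
    proof (cases "q \<in> E")
      case False
      then obtain e where "e \<in> E" "near 3 q e" using max q by blast
      thus ?thesis using sep[of q e v] q EQ False v by blast
    qed (use q in blast)
  qed
  define C where "C = X - E"
  have C2: "card (nbs v \<inter> C) \<le> 2" if vC: "v \<in> C" for v
  proof (cases "card (nbs v) = 3")
    case True
    then obtain e where "e \<in> E" "adj v e" using hitE vC C_def by blast
    hence "e \<in> nbs v" "e \<notin> C" by (simp_all add: C_def)
    hence "nbs v \<inter> C \<subset> nbs v" by blast
    hence "card (nbs v \<inter> C) < card (nbs v)" by (intro psubset_card_mono) auto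
    thus ?thesis using True by simp
  next
    case False
    have "card (nbs v \<inter> C) \<le> card (nbs v)" by (intro card_mono) auto
    thus ?thesis using False card_nbs[of v] by (simp add: nbs_def)
  qed
  have "\<exists>r\<in>C. \<forall>x. adj e x \<longrightarrow> x = r \<or> adj x r" if e: "e \<in> E" for e
  proof -
    obtain r where r: "r \<noteq> e" "\<forall>x. adj e x \<longrightarrow> x = r \<or> adj x r" using Q(2) EQ e by blast
    obtain x where x: "adj e x" using Q(3)[of e] EQ e by fastforce
    have "x \<in> X" using x e EQ Q(1) X(2) adj_closedD by blast
    hence "r \<in> X" using r x X(2) adj_closedD by blast
    \<comment> \<open>A dominating vertex is at distance at most 2 from the deleted one, so
      separation keeps it out of \<open>E\<close> and the retraction lands in the core.\<close>
    moreover have "near 2 e r" using r x near2 near2' by blast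
    hence "r \<notin> E" using far[of e r] e r(1) by metis
    ultimately show ?thesis using r C_def by blast
  qed
  then obtain r where r: "\<And>e. e \<in> E \<Longrightarrow> r e \<in> C"
    and rx: "\<And>e x. e \<in> E \<Longrightarrow> adj e x \<Longrightarrow> x = r e \<or> adj x (r e)" by metis
  define \<rho> where "\<rho> u = (if u \<in> E then r u else u)" for u
  have \<rho>C: "\<rho> u \<in> C" if "u \<in> X" for u using that r by (simp add: \<rho>_def C_def)
  \<comment> \<open>No two deleted vertices are adjacent, so at most one end of an edge is moved,
    and domination keeps its image equal or adjacent to the other end.\<close>
  have weak: "\<rho> u = \<rho> w \<or> adj (\<rho> u) (\<rho> w)" if "adj u w" for u w
  proof -
    have "\<not> (u \<in> E \<and> w \<in> E)" using that far near2 adj_irrefl by metis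
    thus ?thesis using rx[of u w] rx[of w u] that adj_sym unfolding \<rho>_def by metis
  qed
  have "C \<noteq> {}" using X(3) \<rho>C by blast
  moreover have "finite C" using X(1) C_def by simp
  ultimately obtain p where p: "p \<noteq> []" "simple_path p" "set p \<subseteq> C"
    and padj: "\<And>i w. i < length p \<Longrightarrow> w \<in> C \<Longrightarrow> adj (p ! i) w \<Longrightarrow> \<exists>j<length p. w = p ! j \<and>
       (j = Suc i \<or> i = Suc j \<or> i = 0 \<and> j = length p - 1 \<or> j = 0 \<and> i = length p - 1)"
    using closed_path[of C] C2 by blast
  have dist: "distinct p" using p(2) by (simp add: simple_path_def)
  have padj': "j = Suc i \<or> i = Suc j \<or> i = 0 \<and> j = length p - 1 \<or> j = 0 \<and> i = length p - 1"
    if ij: "i < length p" "j < length p" "adj (p ! i) (p ! j)" for i j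
  proof -
    have "p ! j \<in> C" using p(3) ij by auto
    then obtain k where k: "k < length p" "p ! j = p ! k"
       "k = Suc i \<or> i = Suc k \<or> i = 0 \<and> k = length p - 1 \<or> k = 0 \<and> i = length p - 1"
      using padj ij by metis
    moreover have "j = k" using k(1,2) ij dist nth_eq_iff_index_eq by blast
    ultimately show ?thesis by blast
  qed
  \<comment> \<open>Taking the preimage puts each deleted vertex into the piece of the vertex that
    dominates it, which makes \<open>Z\<close> closed.\<close>
  define Z where "Z = {u \<in> X. \<rho> u \<in> set p}"
  have ZX: "Z \<subseteq> X" by (auto simp: Z_def)
  have Zc: "adj_closed Z" unfolding adj_closed_def
  proof (intro ballI subsetI)
    fix u w assume u: "u \<in> Z" and "w \<in> nbs u"
    hence uw: "adj u w" by simp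
    hence w: "w \<in> X" using u ZX X(2) adj_closedD by blast
    obtain i where i: "i < length p" "\<rho> u = p ! i" using u by (auto simp: Z_def in_set_conv_nth)
    have "\<rho> w \<in> set p"
    proof (cases "\<rho> u = \<rho> w")
      case True thus ?thesis using i by (metis nth_mem)
    next
      case False
      hence "adj (p ! i) (\<rho> w)" using weak[OF uw] i by simp
      thus ?thesis using padj[OF i(1) \<rho>C[OF w]] nth_mem by metis
    qed
    thus "w \<in> Z" using w by (simp add: Z_def)
  qed
  have ZE: "Z - E = set p"
  proof -
    have "u \<in> Z - E \<longleftrightarrow> u \<in> set p" for u
    proof (cases "u \<in> E")
      case True thus ?thesis using p(3) C_def by auto
    next
      case False thus ?thesis using p(3) by (auto simp: Z_def \<rho>_def C_def)
    qed
    thus ?thesis by blast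
  qed
  hence Zne: "Z \<noteq> {}" using p(1) by auto
  define ix where "ix x = (SOME k. k < length p \<and> p ! k = x)" for x
  have ix: "ix x < length p \<and> p ! ix x = x" if "x \<in> set p" for x
    unfolding ix_def by (rule someI_ex) (use that in \<open>auto simp: in_set_conv_nth\<close>)
  define \<phi> where "\<phi> u = ix (\<rho> u)" for u
  \<comment> \<open>The bound 3 keeps a single edge, whose two ends are adjacent as well, from
    counting as a cycle.\<close>
  define cyc where "cyc \<longleftrightarrow> 3 \<le> length p \<and> adj (p ! 0) (p ! (length p - 1))"
  \<comment> \<open>For a path this gives \<open>N \<ge> 7\<close>, which is clear of 5.\<close>
  define N where "N = (if cyc then length p else length p + 6)"
  have N3: "3 \<le> N" by (simp add: N_def cyc_def)
  have \<phi>: "\<phi> u < length p" "p ! \<phi> u = \<rho> u" if "u \<in> Z" for u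
    using ix[of "\<rho> u"] that by (auto simp: Z_def \<phi>_def)
  have "\<exists>d. \<bar>d\<bar> \<le> 1 \<and> int N dvd int (\<phi> w) - int (\<phi> u) - d" if u: "u \<in> Z" and uw: "adj u w" for u w
  proof -
    have w: "w \<in> Z" using u uw Zc adj_closedD by blast
    show ?thesis
    proof (cases "\<rho> u = \<rho> w")
      case True thus ?thesis by (intro exI[of _ 0]) (simp add: \<phi>_def)
    next
      case False
      hence a: "adj (p ! \<phi> u) (p ! \<phi> w)" using weak[OF uw] \<phi> u w by simp
      define i j where "i = \<phi> u" and "j = \<phi> w"
      have lt: "i < length p" "j < length p" using \<phi> u w by (simp_all add: i_def j_def)
      have aij: "adj (p ! i) (p ! j)" using a by (simp add: i_def j_def)
      have "\<exists>d. \<bar>d\<bar> \<le> 1 \<and> int N dvd int j - int i - d"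
      proof -
        consider "j = Suc i" | "i = Suc j" | "i = 0" "j = length p - 1" "j \<noteq> Suc i"
          | "j = 0" "i = length p - 1" "i \<noteq> Suc j" using padj'[OF lt aij] by blast
        thus ?thesis
        proof cases
          case 1 thus ?thesis by (intro exI[of _ 1]) simp
        next
          case 2 thus ?thesis by (intro exI[of _ "-1"]) simp
        next
          case 3
          have "j \<noteq> 0" using aij 3 adj_irrefl by metis
          hence "3 \<le> length p" using 3 by linarith
          hence cyc using aij 3 by (simp add: cyc_def)
          hence "N = j + 1" using 3 lt by (auto simp: N_def)
          hence "int N = int j - int i - (-1)" using 3 by simp
          thus ?thesis by (intro exI[of _ "-1"]) simp
        next
          case 4
          have "i \<noteq> 0" using aij 4 adj_irrefl by metis
          hence "3 \<le> length p" using 4 by linarith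
          hence cyc using aij 4 adj_sym by (simp add: cyc_def)
          hence "N = i + 1" using 4 lt by (auto simp: N_def)
          hence "- int N = int j - int i - 1" using 4 by simp
          hence "int N dvd int j - int i - 1" by (metis dvd_minus_iff dvd_refl minus_dvd_iff)
          thus ?thesis by (intro exI[of _ "1"]) simp
        qed
      qed
      thus ?thesis by (simp add: i_def j_def)
    qed
  qed
  moreover have "\<phi> u < N" if "u \<in> Z" for u
    using \<phi>(1)[OF that] by (simp add: N_def)
  moreover have "inj_on \<phi> (Z - E)"
  proof (rule inj_onI)
    fix u w assume "u \<in> Z - E" "w \<in> Z - E" "\<phi> u = \<phi> w"
    moreover from this have "\<rho> u = \<rho> w" using \<phi>(2)[of u] \<phi>(2)[of w] by simp
    ultimately show "u = w" by (simp add: \<rho>_def)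
  qed
  moreover have "length p = 5 \<and> adj (p ! 0) (p ! 4)" if "N = 5"
    using that by (auto simp: N_def cyc_def split: if_splits)
  ultimately show ?thesis using that[of Z N \<phi> E p] ZX Zne Zc N3 E EQ ZE p(2) padj' by blast
qed

section \<open>Choice of the deleted vertices\<close>

lemma adj_iff_two: "nbs u = {x, y} \<Longrightarrow> adj u w \<longleftrightarrow> w = x \<or> w = y"
  using in_nbs[of w u] by simp

lemma adj_iff_three: "nbs u = {x, y, z} \<Longrightarrow> adj u w \<longleftrightarrow> w = x \<or> w = y \<or> w = z"
  using in_nbs[of w u] by simp

lemma nbs_eq_three:
  assumes "adj u x" "adj u y" "adj u z" "x \<noteq> y" "x \<noteq> z" "y \<noteq> z"
  shows "nbs u = {x, y, z}"
proof -
  have "{x, y, z} \<subseteq> nbs u" "card {x, y, z} = 3" using assms by simp_all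
  moreover have "card (nbs u) \<le> 3" using card_nbs by (simp add: nbs_def)
  ultimately show ?thesis by (metis card_seteq finite_nbs')
qed

lemma card_nbs_three:
  assumes "adj u x" "adj u y" "adj u z" "x \<noteq> y" "x \<noteq> z" "y \<noteq> z"
  shows "card (nbs u) = 3"
  using nbs_eq_three[OF assms] assms by simp

lemma nbs_eq_two:
  assumes "adj u x" "adj u y" "x \<noteq> y" "card (nbs u) \<noteq> 3"
  shows "nbs u = {x, y}"
  using assms card_nbs_three[of u x y] by (auto simp: nbs_def)

text \<open>With all neighbourhoods prescribed this is a whole component. The vertices of degree 2
  next to \<open>v\<close> are \<open>a\<close>, \<open>b\<close>, those next to \<open>u\<close>
  are \<open>c\<close>, \<open>d\<close>, and any two from different triangles are only 3
  apart.\<close>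

definition is_bow :: "'a \<Rightarrow> 'a \<Rightarrow> 'a \<Rightarrow> 'a \<Rightarrow> 'a \<Rightarrow> 'a \<Rightarrow> bool" where
  "is_bow a b v u c d \<longleftrightarrow> distinct [a, b, v, u, c, d] \<and> nbs a = {b, v} \<and> nbs b = {a, v} \<and>
     nbs v = {a, b, u} \<and> nbs u = {v, c, d} \<and> nbs c = {d, u} \<and> nbs d = {c, u}"

lemma near_3E:
  assumes "near 3 q e" "q \<noteq> e" "\<not> adj q e"
  obtains p1 p2 where "adj q p1" "adj p2 e" "p1 = p2 \<or> adj p1 p2"
  using assms by (auto simp: numeral_3_eq_3)

section \<open>Candidates in case (a): pairwise non-adjacent 3-vertices on triangles or
  4-cycles\<close>

text \<open>
  Without the condition on \<open>v\<close>, the vertex opposite the only 3-vertex of a 4-cycle would qualify and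
  its choice could keep both neighbours of that 3-vertex from being deleted.
\<close>

definition sparse_extra :: "'a set" where
  "sparse_extra = {q. card (nbs q) = 2 \<and> (\<exists>v. adj q v \<and> card (nbs v) = 3) \<and>
     (\<exists>r. r \<noteq> q \<and> (\<forall>x. adj q x \<longrightarrow> x = r \<or> adj x r))}"

text \<open>Being next to a 3-vertex, \<open>x\<close> has degree at most 2, so its neighbours all
  lie on the short cycle, where \<open>y\<close> dominates \<open>x\<close>.\<close>

lemma sparse_extra_hit:
  assumes ind: "\<forall>v w. adj v w \<longrightarrow> card (nbs v) = 3 \<longrightarrow> card (nbs w) \<noteq> 3"
    and cyc: "adj v x" "adj v y" "x \<noteq> y" "adj x y \<or> (\<exists>w. w \<noteq> v \<and> adj w x \<and> adj w y)"
    and v: "card (nbs v) = 3"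
  shows "x \<in> sparse_extra"
proof -
  have x: "card (nbs x) \<noteq> 3" using ind cyc v by blast
  have xv: "adj x v" using cyc adj_sym by blast
  show ?thesis
  proof (cases "adj x y")
    case True
    have "v \<noteq> y" using cyc adj_irrefl by blast
    hence "nbs x = {v, y}" using nbs_eq_two xv True x by simp
    hence "card (nbs x) = 2" "\<forall>z. adj x z \<longrightarrow> z = y \<or> adj z y" using \<open>v \<noteq> y\<close> cyc(2) in_nbs by auto
    thus ?thesis unfolding sparse_extra_def mem_Collect_eq using xv v cyc(3) by metis
  next
    case False
    then obtain w where w: "w \<noteq> v" "adj w x" "adj w y" using cyc by blast
    hence "nbs x = {v, w}" using nbs_eq_two xv adj_sym x by metis
    hence "card (nbs x) = 2" "\<forall>z. adj x z \<longrightarrow> z = y \<or> adj z y" using w cyc(2) in_nbs by auto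
    thus ?thesis unfolding sparse_extra_def mem_Collect_eq using xv v cyc(3) by metis
  qed
qed

text \<open>The shapes are a triangle hanging at \<open>v\<close>, a pair of twins between two
  3-vertices, and a 4-cycle whose only 3-vertex is \<open>v\<close>. Outside the triangle, the
  dominating vertex is next to the 3-vertex \<open>v\<close>, so it has degree 2 and is a twin of
  \<open>q\<close>.\<close>

lemma sparse_extra_shape:
  assumes ind: "\<forall>v w. adj v w \<longrightarrow> card (nbs v) = 3 \<longrightarrow> card (nbs w) \<noteq> 3"
    and q: "q \<in> sparse_extra" and v: "card (nbs v) = 3" "adj v q"
  obtains z where "z \<noteq> v" "nbs q = {v, z}" "nbs z = {q, v}"
  | z r where "z \<noteq> v" "nbs q = {v, z}" "r \<noteq> q" "nbs r = {v, z}" "card (nbs r) = 2" "card (nbs z) = 3"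
  | z r where "z \<noteq> v" "nbs q = {v, z}" "r \<noteq> q" "nbs r = {v, z}" "nbs z = {q, r}"
      "card (nbs r) = 2"
proof -
  have "card (nbs q) = 2" using q sparse_extra_def by blast
  then obtain a b where ab: "nbs q = {a, b}" "a \<noteq> b" by (meson card_2_iff)
  have "v \<in> nbs q" using v adj_sym by simp
  hence "v = a \<or> v = b" using ab by blast
  then obtain z where z: "nbs q = {v, z}" "z \<noteq> v" using ab insert_commute by metis
  have qz: "adj q z" "adj q v" using z in_nbs by blast+
  obtain r where r: "r \<noteq> q" "\<forall>x. adj q x \<longrightarrow> x = r \<or> adj x r" using q sparse_extra_def by blast
  have vr: "v = r \<or> adj v r" "z = r \<or> adj z r" using r qz by blast+
  show thesis
  proof (cases "adj v z")
    case True
    hence "card (nbs z) \<noteq> 3" using ind v by blast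
    hence "nbs z = {q, v}" using nbs_eq_two[of z q v] qz True v adj_sym adj_irrefl by metis
    thus thesis using that(1) z by blast
  next
    case False
    hence vr: "adj v r" "adj z r" using vr adj_sym z by blast+
    have r3: "card (nbs r) \<noteq> 3" using ind v vr by blast
    hence nr: "nbs r = {v, z}" using nbs_eq_two[of r v z] vr adj_sym z by metis
    hence r2: "card (nbs r) = 2" using z by simp
    show thesis
    proof (cases "card (nbs z) = 3")
      case True thus thesis using that(2) z r nr r2 by blast
    next
      case False
      hence "nbs z = {q, r}" using nbs_eq_two[of z q r] qz vr adj_sym r by metis
      thus thesis using that(3) z r nr r2 by blast
    qed
  qed
qed

text \<open>If \<open>t\<close> is not \<open>v\<close>, then \<open>q\<close> has a twin
  \<open>r\<close> between \<open>v\<close> and \<open>t\<close>. A third candidate \<open>e\<close>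
  at \<open>t\<close> completes the neighbourhood of \<open>t\<close>, so the twin of
  \<open>e\<close> must be \<open>q\<close> or \<open>r\<close>; hence \<open>e\<close> is adjacent
  to \<open>v\<close> as well, and \<open>q\<close>, \<open>r\<close>, \<open>e\<close> are three
  twins.\<close>

lemma sparse_extra_sep_three:
  assumes ind: "\<forall>v w. adj v w \<longrightarrow> card (nbs v) = 3 \<longrightarrow> card (nbs w) \<noteq> 3"
    and q: "q \<in> sparse_extra" and e: "e \<in> sparse_extra" and "q \<noteq> e"
    and v: "card (nbs v) = 3" "adj v q" and t: "card (nbs t) = 3" "adj t q" "adj t e"
  shows "adj v e"
proof (cases "t = v")
  case False
  have tq: "t \<in> nbs q" using t adj_sym by simp
  obtain r where z: "nbs q = {v, t}" and r: "r \<noteq> q" "nbs r = {v, t}"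
  proof (rule sparse_extra_shape[OF ind q v])
    fix z assume "nbs q = {v, z}" "nbs z = {q, v}"
    moreover from this have "z = t" using tq False by auto
    moreover from calculation have "adj t v" using in_nbs by blast
    ultimately show thesis using ind t v by blast
  next
    fix z r assume "nbs q = {v, z}" "r \<noteq> q" "nbs r = {v, z}"
    thus thesis using that tq False by blast
  next
    fix z r assume "nbs q = {v, z}" "r \<noteq> q" "nbs r = {v, z}"
    thus thesis using that tq False by blast
  qed
  have ve: "v \<noteq> e" using v e sparse_extra_def by auto
  have rt: "adj t r" using r adj_sym in_nbs by blast
  show ?thesis
  proof (cases "e = r")
    case True
    have "adj r v" using r in_nbs by blast
    thus ?thesis using True adj_sym by blast
  next
    case er: False
    have nt: "nbs t = {q, r, e}" using nbs_eq_three[of t q r e] t rt r er \<open>q \<noteq> e\<close> by metis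
    show ?thesis
    proof (rule sparse_extra_shape[OF ind e t(1,3)])
      fix w assume w: "w \<noteq> t" "nbs e = {t, w}" "nbs w = {e, t}"
      have "w \<in> nbs t" using w adj_sym in_nbs by blast
      moreover have "w \<noteq> e" using w(2) adj_irrefl in_nbs by blast
      ultimately have "w = q \<or> w = r" using nt by blast
      hence "e \<in> {v, t}" using w z r by auto
      hence "e = t" using ve by blast
      thus ?thesis using t adj_irrefl by blast
    next
      fix w s assume w: "w \<noteq> t" "nbs e = {t, w}" "s \<noteq> e" "nbs s = {t, w}"
      have "s \<in> nbs t" using w adj_sym in_nbs by blast
      hence "s = q \<or> s = r" using nt w by blast
      hence "w = v" using w z r False by (metis doubleton_eq_iff)
      thus ?thesis using w adj_sym in_nbs by blast
    next
      fix w s assume w: "w \<noteq> t" "nbs e = {t, w}" "s \<noteq> e" "nbs s = {t, w}"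
      have "s \<in> nbs t" using w adj_sym in_nbs by blast
      hence "s = q \<or> s = r" using nt w by blast
      hence "w = v" using w z r False by (metis doubleton_eq_iff)
      thus ?thesis using w adj_sym in_nbs by blast
    qed
  qed
qed (use t in blast)

text \<open>As \<open>p1\<close> is not a 3-vertex, it is the neighbour of \<open>q\<close> other
  than \<open>v\<close>, and the shape is a triangle or 4-cycle whose only exit is \<open>v\<close>.
  A short walk onwards from \<open>p1\<close> stays on this cycle or leaves it at \<open>v\<close>,
  so its end \<open>e\<close> is next to \<open>v\<close>.\<close>

lemma sparse_extra_sep_two:
  assumes ind: "\<forall>v w. adj v w \<longrightarrow> card (nbs v) = 3 \<longrightarrow> card (nbs w) \<noteq> 3"
    and q: "q \<in> sparse_extra" and e: "e \<in> sparse_extra" and qe: "q \<noteq> e"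
    and v: "card (nbs v) = 3" "adj v q"
    and p: "adj q p1" "card (nbs p1) \<noteq> 3" "adj p2 e" "p1 = p2 \<or> adj p1 p2"
  shows "adj v e"
proof -
  have ve: "v \<noteq> e" using v e sparse_extra_def by auto
  have pv: "p1 \<noteq> v" using p v by blast
  obtain u where u: "adj e u" "card (nbs u) = 3" using e sparse_extra_def by blast
  show ?thesis
  proof (rule sparse_extra_shape[OF ind q v])
    fix z assume z: "z \<noteq> v" "nbs q = {v, z}" "nbs z = {q, v}"
    have vz: "adj v z" using z adj_sym in_nbs by blast
    have "p1 = z" using p z pv in_nbs by blast
    hence "p2 = z \<or> p2 = q \<or> p2 = v" using p(4) z in_nbs by blast
    thus ?thesis
    proof (elim disjE)
      assume "p2 = z"
      thus ?thesis using p(3) adj_iff_two[OF z(3)] qe ve by metis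
    next
      assume "p2 = q"
      thus ?thesis using p(3) adj_iff_two[OF z(2)] ve vz by metis
    next
      assume "p2 = v" thus ?thesis using p by blast
    qed
  next
    fix z r assume z: "z \<noteq> v" "nbs q = {v, z}" "card (nbs z) = 3"
    have "p1 = z" using p z pv in_nbs by blast
    thus ?thesis using p z by blast
  next
    fix z r assume z: "z \<noteq> v" "nbs q = {v, z}" "r \<noteq> q" "nbs r = {v, z}" "nbs z = {q, r}"
      "card (nbs r) = 2"
    have q2: "card (nbs q) = 2" using q sparse_extra_def by blast
    \<comment> \<open>The vertex opposite \<open>v\<close> has only neighbours of degree 2; here the
      requirement of a neighbouring 3-vertex in \<open>sparse_extra\<close> takes effect.\<close>
    have ez: "e \<noteq> z"
    proof
      assume "e = z"
      hence "u = q \<or> u = r" using u z in_nbs by blast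
      thus False using u z q2 by auto
    qed
    have "p1 = z" using p z pv in_nbs by blast
    hence "p2 = z \<or> p2 = q \<or> p2 = r" using p(4) z in_nbs by blast
    moreover have "adj v r" using z adj_sym in_nbs by blast
    ultimately show ?thesis using p(3) ve ez qe
      adj_iff_two[OF z(2)] adj_iff_two[OF z(4)] adj_iff_two[OF z(5)] by metis
  qed
qed

text \<open>On a path \<open>q\<close>, \<open>p1\<close>, \<open>p2\<close>, \<open>e\<close> two
  inner 3-vertices must coincide, since 3-vertices are not adjacent. If only \<open>p1\<close> is
  one, the previous argument is run from \<open>e\<close> and produces a 3-vertex adjacent to both
  candidates.\<close>

lemma sparse_extra_sep:
  assumes ind: "\<forall>v w. adj v w \<longrightarrow> card (nbs v) = 3 \<longrightarrow> card (nbs w) \<noteq> 3"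
    and q: "q \<in> sparse_extra" and e: "e \<in> sparse_extra" and qe: "q \<noteq> e" and n: "near 3 q e"
    and v: "card (nbs v) = 3" "adj v q"
  shows "adj v e"
proof (cases "adj q e")
  case True
  have "card (nbs e) \<noteq> 3" using e sparse_extra_def by auto
  moreover obtain u where "adj e u" using e sparse_extra_def by blast
  ultimately show ?thesis
    using sparse_extra_sep_two[OF ind q e qe v True, of u] adj_sym by blast
next
  case False
  then obtain p1 p2 where p: "adj q p1" "adj p2 e" "p1 = p2 \<or> adj p1 p2"
    using near_3E[OF n qe] by blast
  show ?thesis
  proof (cases "card (nbs p1) = 3")
    case p1: True
    show ?thesis
    proof (cases "card (nbs p2) = 3")
      case True
      hence "p1 = p2" using p ind p1 by blast
      thus ?thesis using sparse_extra_sep_three[OF ind q e qe v p1] p adj_sym by blast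
    next
      case p2: False
      obtain u where u: "card (nbs u) = 3" "adj u e" using e sparse_extra_def adj_sym by blast
      have "adj u q"
        using sparse_extra_sep_two[OF ind e q qe[symmetric] u _ p2, of p1] p adj_sym by blast
      thus ?thesis using sparse_extra_sep_three[OF ind q e qe v u(1)] u by blast
    qed
  next
    case False
    thus ?thesis using sparse_extra_sep_two[OF ind q e qe v p(1)] p by blast
  qed
qed

section \<open>Candidates in case (b): 3-vertices on triangles\<close>

text \<open>
  In case (b) the dominating vertex must be a neighbour: for a 4-cycle with one edge \<open>vr\<close> completed to
  a triangle, deleting a further neighbour of \<open>v\<close> on the 4-cycle would leave \<open>r\<close> of degree 3.
\<close>

definition triangle_extra :: "'a set" where
  "triangle_extra = {q. \<exists>v z. card (nbs v) = 3 \<and> v \<noteq> z \<and> nbs q = {v, z} \<and> adj v z}"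

lemma triangle_extra_hit:
  assumes one: "\<forall>v x y. card (nbs v) = 3 \<longrightarrow> adj v x \<longrightarrow> adj v y \<longrightarrow> card (nbs x) = 3 \<longrightarrow>
      card (nbs y) = 3 \<longrightarrow> x = y"
    and v: "card (nbs v) = 3" "adj v x" "adj v y" "adj x y"
  shows "\<exists>q\<in>triangle_extra. adj v q"
proof -
  have *: "x \<in> triangle_extra" if "card (nbs x) \<noteq> 3" "adj v x" "adj v y" "adj x y" for x y
  proof -
    have "adj x v" "v \<noteq> y" using that adj_sym adj_irrefl by metis+
    hence "nbs x = {v, y}" using nbs_eq_two that by metis
    thus ?thesis unfolding triangle_extra_def mem_Collect_eq using v that \<open>v \<noteq> y\<close> by metis
  qed
  have "card (nbs x) \<noteq> 3 \<or> card (nbs y) \<noteq> 3" using one v adj_irrefl by metis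
  thus ?thesis using *[of x y] *[of y x] v adj_sym by metis
qed

lemma triangle_extra_shape:
  assumes "q \<in> triangle_extra" "adj q x"
  obtains y where "y \<noteq> x" "nbs q = {x, y}" "adj x y"
proof -
  obtain v z where vz: "v \<noteq> z" "nbs q = {v, z}" "adj v z" using assms triangle_extra_def by auto
  hence "x = v \<or> x = z" using assms(2) adj_iff_two by metis
  thus ?thesis
  proof
    assume "x = v" thus ?thesis using that[of z] vz by blast
  next
    assume "x = z"
    moreover have "nbs q = {z, v}" using vz(2) by (simp add: insert_commute)
    ultimately show ?thesis using that[of v] vz adj_sym by metis
  qed
qed

text \<open>Otherwise \<open>q\<close> and \<open>e\<close> lie in disjoint triangles joined by an
  edge ending at \<open>p2\<close>. If this edge starts at \<open>v\<close>, its ends are adjacent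
  3-vertices, so both third corners have degree 2 and the bow is complete. If it starts at the third
  corner \<open>z\<close>, then \<open>z\<close> is a 3-vertex with the two 3-neighbours
  \<open>v\<close> and \<open>p2\<close>.\<close>

lemma triangle_extra_sep:
  assumes one: "\<forall>v x y. card (nbs v) = 3 \<longrightarrow> adj v x \<longrightarrow> adj v y \<longrightarrow> card (nbs x) = 3 \<longrightarrow>
      card (nbs y) = 3 \<longrightarrow> x = y"
    and q: "q \<in> triangle_extra" and e: "e \<in> triangle_extra" and qe: "q \<noteq> e" and n: "near 3 q e"
    and v: "card (nbs v) = 3" "adj v q"
  shows "adj v e \<or> (\<exists>b v' u c d. is_bow q b v' u c d)"
proof (rule ccontr)
  assume neg: "\<not> ?thesis"
  obtain z where z: "z \<noteq> v" "nbs q = {v, z}" "adj v z"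
    using triangle_extra_shape[OF q] v adj_sym by metis
  note q_iff = adj_iff_two[OF z(2)]
  have e2: "card (nbs e) = 2" using e by (auto simp: triangle_extra_def)
  have ev: "e \<noteq> v" "e \<noteq> z" using e2 v z neg by auto
  have qz: "adj z q" "adj z v" "q \<noteq> v" "q \<noteq> z" using q_iff z adj_sym adj_irrefl by metis+
  have nqe: "\<not> adj q e" using q_iff ev by blast
  obtain p1 p2 where p: "adj q p1" "adj p2 e" "p1 = p2 \<or> adj p1 p2" using near_3E[OF n qe nqe] .
  have ep: "adj e p2" using p adj_sym by blast
  obtain p' where p': "p' \<noteq> p2" "nbs e = {p2, p'}" "adj p2 p'" using triangle_extra_shape[OF e ep] .
  have p'e: "adj p' e" "p' \<noteq> e" "p2 \<noteq> e" using p' adj_iff_two adj_sym adj_irrefl by metis+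
  have vp: "p2 \<noteq> v" "p' \<noteq> v" using p p'e neg by blast+
  have qp: "p2 \<noteq> q" "p' \<noteq> q" using p(2) p'e nqe by blast+
  have zp: "p2 \<noteq> z"
  proof
    assume "p2 = z"
    hence "nbs z = {q, v, e}" using nbs_eq_three[of z q v e] qz p(2) ev qe by metis
    hence "p' = q \<or> p' = v \<or> p' = e" using p'(3) \<open>p2 = z\<close> adj_iff_three by metis
    thus False using vp qp p'e by blast
  qed
  hence "p1 = v \<or> p1 = z" "adj p1 p2" using p q_iff vp by blast+
  thus False
  proof (elim disjE)
    assume "p1 = v"
    hence vp2: "adj v p2" using \<open>adj p1 p2\<close> by blast
    have nv: "nbs v = {q, z, p2}" using nbs_eq_three[of v q z p2] v z vp2 qz qp zp by metis
    have np2: "nbs p2 = {v, e, p'}" using nbs_eq_three[of p2 v e p'] vp2 p p' ev vp p'e adj_sym by metis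
    have p23: "card (nbs p2) = 3" using np2 ev vp p'e by auto
    have "card (nbs z) \<noteq> 3" using one v z(3) vp2 p23 zp by metis
    hence nz: "nbs z = {q, v}" using nbs_eq_two qz by metis
    have "card (nbs p') \<noteq> 3" using one p23 p'(3) vp2 v(1) vp adj_sym by metis
    hence np': "nbs p' = {e, p2}" using nbs_eq_two[of p' e p2] p'e p' adj_sym by metis
    have "p' \<noteq> z" using p'e(1) adj_iff_two[OF nz] qe ev by metis
    hence "distinct [q, z, v, p2, e, p']"
      using qz qp qe z zp ev vp p'e p' by auto
    hence "is_bow q z v p2 e p'"
      unfolding is_bow_def using z nz nv np2 p' np' by (simp add: insert_commute)
    thus False using neg by blast
  next
    assume "p1 = z"
    hence zp2: "adj z p2" using \<open>adj p1 p2\<close> by blast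
    have nz: "nbs z = {q, v, p2}" using nbs_eq_three[of z q v p2] qz zp2 qp vp by metis
    have z3: "card (nbs z) = 3" using nz qz qp vp by auto
    have "card (nbs p2) \<noteq> 3" using one z3 zp2 qz(2) v(1) vp by metis
    moreover have "e \<noteq> z" by (rule ev)
    moreover have "p' \<noteq> z" using p'e(1) adj_iff_three[OF nz] qe ev p'e by metis
    ultimately show False using card_nbs_three[of p2 z e p'] zp2 p p' p'e adj_sym by metis
  qed
qed

text \<open>For explicit lists, \<open>sorted_wrt\<close> simplifies to one nearness condition per
  pair of equally coloured vertices; symmetry of \<open>near\<close> supplies the other
  order.\<close>

lemma pack_colorable_on_list:
  assumes len: "length cs = length xs" and cs: "\<forall>k\<in>set cs. k < length S"
    and wrt: "sorted_wrt (\<lambda>(x, i) (y, j). i = j \<longrightarrow> \<not> near (S ! i) x y) (zip xs cs)"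
  shows "pack_colorable_on S (set xs)"
proof -
  define ix where "ix x = (SOME k. k < length xs \<and> xs ! k = x)" for x
  have ix: "ix x < length xs \<and> xs ! ix x = x" if "x \<in> set xs" for x
    using that unfolding ix_def in_set_conv_nth by (rule someI_ex)
  have lt: "\<not> near (S ! (cs ! i)) (xs ! i) (xs ! j)" if "i < j" "j < length xs" "cs ! i = cs ! j" for i j
    using sorted_wrt_nth_less[OF wrt, of i j] that len by simp
  have nn: "\<not> near (S ! (cs ! ix x)) x y"
    if xy: "x \<in> set xs" "y \<in> set xs" "x \<noteq> y" "cs ! ix x = cs ! ix y" for x y
  proof -
    have "ix x \<noteq> ix y" using ix xy by metis
    hence "ix x < ix y \<or> ix y < ix x" by linarith
    thus ?thesis
    proof
      assume "ix x < ix y"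
      thus ?thesis using lt[of "ix x" "ix y"] ix[OF xy(1)] ix[OF xy(2)] xy(4) by metis
    next
      assume "ix y < ix x"
      hence "\<not> near (S ! (cs ! ix x)) y x"
        using lt[of "ix y" "ix x"] ix[OF xy(1)] ix[OF xy(2)] xy(4) by metis
      thus ?thesis using near_sym by blast
    qed
  qed
  have "cs ! ix x < length S" if "x \<in> set xs" for x using ix[OF that] cs len nth_mem by metis
  thus ?thesis unfolding pack_colorable_on_def
    using nn by (intro exI[of _ "\<lambda>x. cs ! ix x"]) blast
qed

section \<open>Exceptional pieces\<close>

text \<open>Vertices of degree 2 in different triangles are 3 apart and may share a colour of value
  2. The colour of value \<open>k\<close> and those of value at least 3 are used at most
  once.\<close>

lemma bow_colorable:
  assumes bow: "is_bow a b v u c d"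
  defines "Z \<equiv> {a, b, v, u, c, d}"
  shows "adj_closed Z" "pack_colorable_on [1, 1, 3, k] Z" "pack_colorable_on [1, 2, 2, 3] Z"
    "pack_colorable_on [2, 2, 2, 2, 3] Z" "pack_colorable_on [1, 2, 3, 4, 5, k] Z"
proof -
  have nb: "distinct [a, b, v, u, c, d]" "nbs a = {b, v}" "nbs b = {a, v}" "nbs v = {a, b, u}"
    "nbs u = {v, c, d}" "nbs c = {d, u}" "nbs d = {c, u}"
    using bow by (simp_all only: is_bow_def)
  show "adj_closed Z" unfolding adj_closed_def Z_def using nb(2-) by simp
  note iffs = adj_iff_two[OF nb(2)] adj_iff_two[OF nb(3)] adj_iff_three[OF nb(4)]
    adj_iff_three[OF nb(5)] adj_iff_two[OF nb(6)] adj_iff_two[OF nb(7)]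
  have far: "\<not> near 2 a c" "\<not> near 2 a d" "\<not> near 2 b c" "\<not> near 2 b d"
    unfolding near_two_iff iffs using nb(1) iffs by auto
  have far1: "\<not> near 1 v c" "\<not> near 1 a u" "\<not> near 1 a c"
    unfolding near_one_iff iffs using nb(1) by auto
  have Z: "Z = set [a, b, v, u, c, d]" by (simp add: Z_def)
  show "pack_colorable_on [1, 1, 3, k] Z" unfolding Z
    using far far1 by (intro pack_colorable_on_list[of "[1, 2, 0, 1, 0, 3]"]) simp_all
  show "pack_colorable_on [1, 2, 2, 3] Z" unfolding Z
    using far far1 by (intro pack_colorable_on_list[of "[1, 2, 0, 3, 0, 1]"]) simp_all
  show "pack_colorable_on [2, 2, 2, 2, 3] Z" unfolding Z
    using far far1 by (intro pack_colorable_on_list[of "[0, 1, 3, 2, 0, 1]"]) simp_all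
  show "pack_colorable_on [1, 2, 3, 4, 5, k] Z" unfolding Z
    using far far1 by (intro pack_colorable_on_list[of "[0, 1, 3, 2, 0, 1]"]) simp_all
qed

text \<open>Chords are excluded, but neighbours off the cycle are left open because deleted vertices
  may be attached.\<close>

definition is_C5 :: "'a \<Rightarrow> 'a \<Rightarrow> 'a \<Rightarrow> 'a \<Rightarrow> 'a \<Rightarrow> bool" where
  "is_C5 a b c d e \<longleftrightarrow> distinct [a, b, c, d, e] \<and> adj a b \<and> adj b c \<and> adj c d \<and> adj d e \<and> adj e a \<and>
     \<not> adj a c \<and> \<not> adj b d \<and> \<not> adj c e \<and> \<not> adj d a \<and> \<not> adj e b"

lemma is_C5_rotate: "is_C5 a b c d e \<Longrightarrow> is_C5 b c d e a"
  by (auto simp: is_C5_def)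

text \<open>Here \<open>f\<close> is a twin of \<open>b\<close>. If \<open>Z\<close> is closed,
  these six vertices have pairwise distance at most 2, so five colours of value at least 2 cannot
  suffice.\<close>

definition G1_on :: "'a set \<Rightarrow> bool" where
  "G1_on Z \<longleftrightarrow> (\<exists>a b c d e f. is_C5 a b c d e \<and> f \<notin> {a, b, c, d, e} \<and> nbs f = {a, c} \<and>
     Z = {a, b, c, d, e, f})"

lemma C5_colorable:
  assumes "is_C5 a b c d e"
  defines "Z \<equiv> {a, b, c, d, e}"
  shows "pack_colorable_on [1, 2, 2, 3] Z" "pack_colorable_on [2, 2, 2, 2, 3] Z"
proof -
  have "\<not> near 1 a c" unfolding near_one_iff using assms by (auto simp: is_C5_def)
  moreover have Z: "Z = set [a, b, c, d, e]" by (simp add: Z_def)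
  ultimately show "pack_colorable_on [1, 2, 2, 3] Z" unfolding Z
    by (intro pack_colorable_on_list[of "[0, 1, 0, 2, 3]"]) simp_all
  show "pack_colorable_on [2, 2, 2, 2, 3] Z" unfolding Z
    by (intro pack_colorable_on_list[of "[0, 1, 2, 3, 4]"]) simp_all
qed

text \<open>The vertex \<open>d\<close> opposite the edge \<open>ab\<close> is at distance 3 from
  \<open>f\<close>, so the two share a colour of value 2; \<open>c\<close>, \<open>e\<close>,
  \<open>f\<close> are independent and share the colour of value 1.\<close>

lemma C5_edge_colorable:
  assumes C5: "is_C5 a b c d e" and f: "f \<notin> {a, b, c, d, e}" "nbs f = {a, b}"
  defines "Z \<equiv> {a, b, c, d, e, f}"
  shows "pack_colorable_on [1, 2, 2, 3] Z" "pack_colorable_on [2, 2, 2, 2, 3] Z"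
proof -
  note iff = adj_iff_two[OF f(2)]
  have "\<not> adj c f" "\<not> adj e f" using iff[of c] iff[of e] adj_sym[of c f] adj_sym[of e f] C5 by (auto simp: is_C5_def)
  hence far1: "\<not> near 1 c f" "\<not> near 1 e f" "\<not> near 1 c e"
    unfolding near_one_iff using C5 f(1) by (auto simp: is_C5_def)
  have "\<not> near 2 f d" unfolding near_two_iff iff using C5 f(1) adj_sym by (auto simp: is_C5_def)
  hence far2: "\<not> near 2 d f" using near_sym by blast
  have Z: "Z = set [a, b, c, d, e, f]" by (simp add: Z_def)
  show "pack_colorable_on [1, 2, 2, 3] Z" unfolding Z
    using far1 by (intro pack_colorable_on_list[of "[1, 2, 0, 3, 0, 0]"]) simp_all
  show "pack_colorable_on [2, 2, 2, 2, 3] Z" unfolding Z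
    using far2 by (intro pack_colorable_on_list[of "[1, 2, 3, 0, 4, 0]"]) simp_all
qed

lemma C5_twin_colorable:
  assumes C5: "is_C5 a b c d e" and f: "f \<notin> {a, b, c, d, e}" "nbs f = {a, c}"
  shows "pack_colorable_on [1, 2, 2, 3] {a, b, c, d, e, f}"
proof -
  note iff = adj_iff_two[OF f(2)]
  have "\<not> adj b f" "\<not> adj d f" using iff[of b] iff[of d] adj_sym[of b f] adj_sym[of d f] C5 by (auto simp: is_C5_def)
  hence far1: "\<not> near 1 b f" "\<not> near 1 d f" "\<not> near 1 b d"
    unfolding near_one_iff using C5 f(1) by (auto simp: is_C5_def)
  have Z: "{a, b, c, d, e, f} = set [a, b, c, d, e, f]" by simp
  show ?thesis unfolding Z
    using far1 by (intro pack_colorable_on_list[of "[1, 0, 2, 0, 3, 0]"]) simp_all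
qed

lemma C5_rotate_to:
  assumes "is_C5 a b c d e" "x \<in> {a, b, c, d, e}"
  obtains b' c' d' e' where "is_C5 x b' c' d' e'" "{x, b', c', d', e'} = {a, b, c, d, e}"
proof -
  note r1 = is_C5_rotate[OF assms(1)]
  note r2 = is_C5_rotate[OF r1]
  note r3 = is_C5_rotate[OF r2]
  note r4 = is_C5_rotate[OF r3]
  from assms(2) consider "x = a" | "x = b" | "x = c" | "x = d" | "x = e" by auto
  thus thesis
  proof cases
    case 1 thus ?thesis using that assms(1) by blast
  next
    case 2 thus ?thesis using that[of c d e a] r1 by (simp add: insert_commute)
  next
    case 3 thus ?thesis using that[of d e a b] r2 by (simp add: insert_commute)
  next
    case 4 thus ?thesis using that[of e a b c] r3 by (simp add: insert_commute)
  next
    case 5 thus ?thesis using that[of a b c d] r4 by (simp add: insert_commute)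
  qed
qed

text \<open>Two vertices of a 5-cycle are adjacent or have a common neighbour on it; a rotation
  starting at the right one of them leaves two patterns.\<close>

lemma C5_chord_cases:
  assumes C5: "is_C5 a b c d e" and xy: "x \<in> {a, b, c, d, e}" "y \<in> {a, b, c, d, e}" "x \<noteq> y"
  obtains a' b' c' d' e' where "is_C5 a' b' c' d' e'" "{a', b', c', d', e'} = {a, b, c, d, e}"
    "{x, y} = {a', b'} \<or> {x, y} = {a', c'}"
proof -
  obtain b' c' d' e' where C: "is_C5 x b' c' d' e'" "{x, b', c', d', e'} = {a, b, c, d, e}"
    using C5_rotate_to[OF C5 xy(1)] .
  note r1 = is_C5_rotate[OF C(1)]
  note r2 = is_C5_rotate[OF r1]
  note r3 = is_C5_rotate[OF r2]
  note r4 = is_C5_rotate[OF r3]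
  have "y \<in> {x, b', c', d', e'}" using xy C(2) by simp
  then consider "y = b'" | "y = c'" | "y = d'" | "y = e'" using xy(3) by blast
  thus thesis
  proof cases
    case 1 thus ?thesis using that C by blast
  next
    case 2 thus ?thesis using that C by blast
  next
    case 3
    have "{d', e', x, b', c'} = {a, b, c, d, e}" unfolding C(2)[symmetric] by (simp add: insert_commute)
    thus ?thesis using that[OF r3] 3 by (simp add: insert_commute)
  next
    case 4
    have "{e', x, b', c', d'} = {a, b, c, d, e}" unfolding C(2)[symmetric] by (simp add: insert_commute)
    thus ?thesis using that[OF r4] 4 by (simp add: insert_commute)
  qed
qed

text \<open>From \<open>f\<close> every cycle vertex except possibly \<open>d\<close> is reached in
  at most two steps, and one of the two neighbours of \<open>g\<close> is not \<open>d\<close>. So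
  separation allows at most one deleted vertex at a 5-cycle.\<close>

lemma C5_extra_unique:
  assumes C5: "is_C5 a b c d e" and f: "adj f a" "adj f b \<or> adj f c"
    and g: "nbs g = {x, y}" "x \<noteq> y" "x \<in> {a, b, c, d, e}" "y \<in> {a, b, c, d, e}"
  shows "near 3 f g"
proof -
  obtain w where w: "adj g w" "w \<in> {a, b, c, e}"
    using g adj_iff_two[OF g(1)] by (metis insertE insertI1 insertI2 singletonD)
  have gw: "adj w g" using w adj_sym by blast
  have ae: "adj a e" "adj a b" "adj b c" using C5 adj_sym by (auto simp: is_C5_def)
  from w(2) consider "w = a" | "w = b" | "w = c" | "w = e" by blast
  thus ?thesis
  proof cases
    case 3
    thus ?thesis using f(2) near_3I[of f c w g] near_3I[of f b w g] gw ae by blast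
  qed (use near_3I[of f a w g] f(1) gw ae in blast)+
qed

lemma five_piece:
  assumes Z: "adj_closed Z" "Z - E = {a, b, c, d, e}" and C5: "is_C5 a b c d e"
    and E: "\<And>u w. u \<in> E \<Longrightarrow> w \<in> E \<Longrightarrow> u \<noteq> w \<Longrightarrow> \<not> near 3 u w"
    and E2: "\<And>f. f \<in> E \<Longrightarrow> card (nbs f) = 2"
  shows "pack_colorable_on [1, 2, 2, 3] Z \<and> (pack_colorable_on [2, 2, 2, 2, 3] Z \<or> G1_on Z)"
proof (cases "Z \<inter> E = {}")
  case True
  hence "Z = {a, b, c, d, e}" using Z(2) by blast
  thus ?thesis using C5_colorable[OF C5] by simp
next
  case False
  then obtain f where f: "f \<in> Z" "f \<in> E" by blast
  have nb: "\<exists>x y. x \<noteq> y \<and> nbs g = {x, y} \<and> x \<in> {a, b, c, d, e} \<and> y \<in> {a, b, c, d, e}"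
    if g: "g \<in> Z" "g \<in> E" for g
  proof -
    obtain x y where xy: "nbs g = {x, y}" "x \<noteq> y" using E2[OF g(2)] by (meson card_2_iff)
    \<comment> \<open>Deleted vertices are pairwise non-adjacent, so the neighbours of one lie in
      the core part of \<open>Z\<close>, the cycle.\<close>
    have "w \<in> {a, b, c, d, e}" if "adj g w" for w
    proof -
      have "near 3 g w" using that near_mono[of 1 3 g w] near_one_iff by simp
      moreover have "g \<noteq> w" using that adj_irrefl by blast
      ultimately have "w \<notin> E" using E[OF g(2)] by blast
      moreover have "w \<in> Z" using that g Z(1) adj_closedD by blast
      ultimately show ?thesis using Z(2) by blast
    qed
    thus ?thesis using xy adj_iff_two[OF xy(1)] by metis
  qed
  obtain x y where xy: "x \<noteq> y" "nbs f = {x, y}" "x \<in> {a, b, c, d, e}" "y \<in> {a, b, c, d, e}"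
    using nb[OF f] by blast
  obtain a' b' c' d' e' where C': "is_C5 a' b' c' d' e'" "{a', b', c', d', e'} = {a, b, c, d, e}"
    "{x, y} = {a', b'} \<or> {x, y} = {a', c'}"
    using C5_chord_cases[OF C5 xy(3,4,1)] .
  have nf: "nbs f = {a', b'} \<or> nbs f = {a', c'}" using C'(3) xy(2) by simp
  have fa: "adj f a'" "adj f b' \<or> adj f c'" using nf adj_iff_two by metis+
  have "g = f" if g: "g \<in> Z" "g \<in> E" for g
  proof -
    obtain u w where "u \<noteq> w" "nbs g = {u, w}" "u \<in> {a, b, c, d, e}" "w \<in> {a, b, c, d, e}"
      using nb[OF g] by blast
    hence "near 3 f g" using C5_extra_unique[OF C'(1) fa] unfolding C'(2) by blast
    thus ?thesis using E[OF f(2) g(2)] by blast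
  qed
  hence "Z = insert f {a', b', c', d', e'}" using f Z(2) C'(2) by blast
  hence ZZ: "Z = {a', b', c', d', e', f}" by (simp add: insert_commute)
  have fn: "f \<notin> {a', b', c', d', e'}" using f Z(2) C'(2) by blast
  show ?thesis
  proof (cases "nbs f = {a', b'}")
    case True
    thus ?thesis using C5_edge_colorable[OF C'(1) fn] ZZ by simp
  next
    case False
    hence nf: "nbs f = {a', c'}" using nf by blast
    have "G1_on Z" unfolding G1_on_def using C'(1) fn nf ZZ by blast
    thus ?thesis using C5_twin_colorable[OF C'(1) fn nf] ZZ by simp
  qed
qed

lemma simple_path_is_C5:
  assumes "simple_path p" "length p = 5" "adj (p ! 0) (p ! 4)"
    and "\<And>i j. i < length p \<Longrightarrow> j < length p \<Longrightarrow> adj (p ! i) (p ! j) \<Longrightarrow>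
       j = Suc i \<or> i = Suc j \<or> i = 0 \<and> j = length p - 1 \<or> j = 0 \<and> i = length p - 1"
  obtains a b c d e where "is_C5 a b c d e" "set p = {a, b, c, d, e}"
proof -
  obtain a b c d e where p: "p = [a, b, c, d, e]"
    using assms(2) by (auto simp: length_Suc_conv numeral_eq_Suc)
  have "adj (p ! i) (p ! Suc i)" if "i < 4" for i
    using assms(1,2) that unfolding simple_path_def by simp
  from this[of 0] this[of 1] this[of 2] this[of 3]
  have "adj a b" "adj b c" "adj c d" "adj d e" by (simp_all add: p)
  moreover have "adj e a" using assms(3) adj_sym by (simp add: p)
  moreover have "\<not> adj a c" "\<not> adj b d" "\<not> adj c e" "\<not> adj d a" "\<not> adj e b"
    using assms(4)[of 0 2] assms(4)[of 1 3] assms(4)[of 2 4] assms(4)[of 3 0] assms(4)[of 4 1]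
    by (auto simp: p)
  moreover have "distinct [a, b, c, d, e]" using assms(1) by (simp add: simple_path_def p)
  ultimately have "is_C5 a b c d e" unfolding is_C5_def by blast
  thus ?thesis using that by (simp add: p)
qed

text \<open>A bow that meets \<open>X\<close> is a closed piece of its own and is split off
  directly. If there is none, the exchange property holds without its exception and
  \<open>closed_piece\<close> applies to the candidates in \<open>X\<close>.\<close>

lemma colorable_piece:
  assumes X: "finite X" "adj_closed X" "X \<noteq> {}"
    and Q: "\<And>q. q \<in> Q \<Longrightarrow> \<exists>r. r \<noteq> q \<and> (\<forall>x. adj q x \<longrightarrow> x = r \<or> adj x r)"
      "\<And>q. q \<in> Q \<Longrightarrow> card (nbs q) = 2"
    and hit: "\<And>v. card (nbs v) = 3 \<Longrightarrow> \<exists>q\<in>Q. adj v q"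
    and sep: "\<And>q e v. q \<in> Q \<Longrightarrow> e \<in> Q \<Longrightarrow> q \<noteq> e \<Longrightarrow> near 3 q e \<Longrightarrow> card (nbs v) = 3 \<Longrightarrow>
      adj v q \<Longrightarrow> adj v e \<or> (\<exists>b v' u c d. is_bow q b v' u c d)"
  shows "\<exists>Z\<subseteq>X. Z \<noteq> {} \<and> adj_closed Z \<and> pack_colorable_on [1, 1, 3, k] Z \<and>
    pack_colorable_on [1, 2, 2, 3] Z \<and> (pack_colorable_on [2, 2, 2, 2, 3] Z \<or> G1_on Z) \<and>
    pack_colorable_on [1, 2, 3, 4, 5, k] Z"
proof (cases "\<exists>a\<in>X. \<exists>b v u c d. is_bow a b v u c d")
  case True
  then obtain a b v u c d where a: "a \<in> X" and bow: "is_bow a b v u c d" by blast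
  let ?Z = "{a, b, v, u, c, d}"
  have "nbs a = {b, v}" "nbs v = {a, b, u}" "nbs u = {v, c, d}"
    using bow by (simp_all only: is_bow_def)
  moreover have "nbs w \<subseteq> X" if "w \<in> X" for w using X(2) that by (simp add: adj_closed_def)
  ultimately have "?Z \<subseteq> X" using a by (metis insert_subset empty_subsetI)
  thus ?thesis using bow_colorable[OF bow] by blast
next
  case False
  show ?thesis
  proof (rule closed_piece[OF X, of "Q \<inter> X"])
    show "Q \<inter> X \<subseteq> X" by blast
    show "\<exists>q\<in>Q \<inter> X. adj v q" if "v \<in> X" "card (nbs v) = 3" for v
      using hit[OF that(2)] X(2) adj_closedD that(1) by blast
    show "adj v e" if "q \<in> Q \<inter> X" "e \<in> Q \<inter> X" "q \<noteq> e" "near 3 q e" "card (nbs v) = 3"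
        "adj v q" for q e v
      using sep[of q e v] that False by blast
    show "nbs q \<noteq> {}" if "q \<in> Q \<inter> X" for q using Q(2)[of q] that by auto
    show "\<exists>r. r \<noteq> q \<and> (\<forall>x. adj q x \<longrightarrow> x = r \<or> adj x r)" if "q \<in> Q \<inter> X" for q
      using Q(1) that by blast
  next
    fix Z E N \<phi> p
    assume Z: "Z \<subseteq> X" "Z \<noteq> {}" "adj_closed Z" and N: "3 \<le> N"
      and hom: "\<And>u w. u \<in> Z \<Longrightarrow> adj u w \<Longrightarrow> \<exists>d. \<bar>d\<bar> \<le> 1 \<and> int N dvd int (\<phi> w) - int (\<phi> u) - d"
      and \<phi>: "\<And>u. u \<in> Z \<Longrightarrow> \<phi> u < N" "inj_on \<phi> (Z - E)"
      and E: "\<And>u w. u \<in> E \<Longrightarrow> w \<in> E \<Longrightarrow> u \<noteq> w \<Longrightarrow> \<not> near 3 u w"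
      and EQ: "E \<subseteq> Q \<inter> X" and p: "Z - E = set p" "simple_path p"
        "\<And>i j. i < length p \<Longrightarrow> j < length p \<Longrightarrow> adj (p ! i) (p ! j) \<Longrightarrow>
         j = Suc i \<or> i = Suc j \<or> i = 0 \<and> j = length p - 1 \<or> j = 0 \<and> i = length p - 1"
        "N = 5 \<Longrightarrow> length p = 5 \<and> adj (p ! 0) (p ! 4)"
    \<comment> \<open>The indices 2, 2, 3, 4 passed below are the positions of the value 3 in the
      respective lists, that is, the colours reserved for \<open>E\<close>.\<close>
    note cyclic = pack_colorable_on_cyclic[OF Z(3) hom \<phi> E]
    have "pack_colorable_on [1, 1, 3, k] Z"
      using cyclic[of "[1, 1, 3, k]" _ 2] cyclic_coloring_11k[OF N, of k] by auto
    moreover have "pack_colorable_on [1, 2, 3, 4, 5, k] Z"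
      using cyclic[of "[1, 2, 3, 4, 5, k]" _ 2] cyclic_coloring_1245k[OF N, of k] by auto
    moreover have "pack_colorable_on [1, 2, 2, 3] Z \<and>
        (pack_colorable_on [2, 2, 2, 2, 3] Z \<or> G1_on Z)"
    proof (cases "N = 5")
      case True
      obtain a b c d e where C5: "is_C5 a b c d e" "set p = {a, b, c, d, e}"
        using simple_path_is_C5[OF p(2) _ _ p(3)] p(4)[OF True] by blast
      have "card (nbs f) = 2" if "f \<in> E" for f using Q(2) EQ that by blast
      thus ?thesis using five_piece[OF Z(3) _ C5(1) E] p(1) C5(2) by simp
    next
      case False
      have "pack_colorable_on [1, 2, 2, 3] Z"
        using cyclic[of "[1, 2, 2, 3]" _ 3] cyclic_coloring_122[OF N False] by auto
      moreover have "pack_colorable_on [2, 2, 2, 2, 3] Z"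
        using cyclic[of "[2, 2, 2, 2, 3]" _ 4] cyclic_coloring_2222[OF N False] by auto
      ultimately show ?thesis by blast
    qed
    ultimately show ?thesis using Z by blast
  qed
qed

section \<open>Colourable pieces in cases (a) and (b)\<close>

lemma sparse_colorable_piece:
  assumes "finite X" "adj_closed X" "X \<noteq> {}"
    and ind: "\<forall>v w. adj v w \<longrightarrow> card (nbs v) = 3 \<longrightarrow> card (nbs w) \<noteq> 3"
    and cyc: "\<And>v. card (nbs v) = 3 \<Longrightarrow> \<exists>x y. adj v x \<and> adj v y \<and> x \<noteq> y \<and>
      (adj x y \<or> (\<exists>w. w \<noteq> v \<and> adj w x \<and> adj w y))"
  shows "\<exists>Z\<subseteq>X. Z \<noteq> {} \<and> adj_closed Z \<and> pack_colorable_on [1, 1, 3, k] Z \<and>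
    pack_colorable_on [1, 2, 2, 3] Z \<and> (pack_colorable_on [2, 2, 2, 2, 3] Z \<or> G1_on Z) \<and>
    pack_colorable_on [1, 2, 3, 4, 5, k] Z"
proof (rule colorable_piece[OF assms(1-3), of sparse_extra])
  show "\<exists>q\<in>sparse_extra. adj v q" if v: "card (nbs v) = 3" for v
    using cyc[OF v] sparse_extra_hit[OF ind _ _ _ _ v] by blast
  show "adj v e \<or> (\<exists>b v' u c d. is_bow q b v' u c d)"
    if "q \<in> sparse_extra" "e \<in> sparse_extra" "q \<noteq> e" "near 3 q e" "card (nbs v) = 3" "adj v q" for q e v
    using sparse_extra_sep[OF ind that] by blast
qed (auto simp: sparse_extra_def)

lemma triangle_colorable_piece:
  assumes "finite X" "adj_closed X" "X \<noteq> {}"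
    and one: "\<forall>v x y. card (nbs v) = 3 \<longrightarrow> adj v x \<longrightarrow> adj v y \<longrightarrow> card (nbs x) = 3 \<longrightarrow>
      card (nbs y) = 3 \<longrightarrow> x = y"
    and cyc: "\<And>v. card (nbs v) = 3 \<Longrightarrow> \<exists>x y. adj v x \<and> adj v y \<and> adj x y"
  shows "\<exists>Z\<subseteq>X. Z \<noteq> {} \<and> adj_closed Z \<and> pack_colorable_on [1, 1, 3, k] Z \<and>
    pack_colorable_on [1, 2, 2, 3] Z \<and> (pack_colorable_on [2, 2, 2, 2, 3] Z \<or> G1_on Z) \<and>
    pack_colorable_on [1, 2, 3, 4, 5, k] Z"
proof (rule colorable_piece[OF assms(1-3), of triangle_extra])
  show "\<exists>q\<in>triangle_extra. adj v q" if v: "card (nbs v) = 3" for v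
    using cyc[OF v] triangle_extra_hit[OF one v] by blast
  show "adj v e \<or> (\<exists>b v' u c d. is_bow q b v' u c d)"
    if "q \<in> triangle_extra" "e \<in> triangle_extra" "q \<noteq> e" "near 3 q e" "card (nbs v) = 3" "adj v q" for q e v
    using triangle_extra_sep[OF one that] by blast
  show "\<exists>r. r \<noteq> q \<and> (\<forall>x. adj q x \<longrightarrow> x = r \<or> adj x r)" if "q \<in> triangle_extra" for q
  proof -
    obtain v z where vz: "nbs q = {v, z}" "adj v z" using \<open>q \<in> triangle_extra\<close> triangle_extra_def by auto
    have "v \<noteq> q" using adj_iff_two[OF vz(1)] adj_irrefl by metis
    thus ?thesis using adj_iff_two[OF vz(1)] vz(2) adj_sym by metis
  qed
  show "card (nbs q) = 2" if "q \<in> triangle_extra" for q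
    using that by (auto simp: triangle_extra_def)
qed

end

section \<open>Pair graphs\<close>

context pair_graph begin

abbreviation edge :: "'a \<Rightarrow> 'a \<Rightarrow> bool" where
  "edge u w \<equiv> (u, w) \<in> parcs G"

lemma edge_sym: "edge u w \<Longrightarrow> edge w u"
  using pair_sym_arcs by (auto simp: symmetric_def dest: symD)

lemma vdegree_eq_card: "vdegree G v = card {w. edge v w}"
proof -
  have "out_arcs (with_proj G) v = Pair v ` {w. edge v w}" by (auto simp: out_arcs_def)
  thus ?thesis by (simp add: out_degree_def card_image inj_on_def)
qed

lemma finite_edge: "finite {w. edge v w}"
  using pair_finite_verts in_arcsD2 by (auto intro: finite_subset[of _ "pverts G"])

lemma subcubic_relation_edge:
  assumes "subcubic G"
  shows "subcubic_relation edge"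
proof
  fix u w
  show "edge u w \<Longrightarrow> edge w u" by (rule edge_sym)
  show "\<not> edge u u" using pair_no_loops by fastforce
  show "finite {w. edge u w}" by (rule finite_edge)
  show "card {w. edge u w} \<le> 3"
  proof (cases "u \<in> pverts G")
    case True thus ?thesis using assms by (simp add: subcubic_def vdegree_eq_card)
  next
    case False
    hence "{w. edge u w} = {}" using in_arcsD1 by blast
    thus ?thesis by simp
  qed
qed

text \<open>The base point \<open>u\<close> of the closed walk need not be \<open>v\<close>; the
  conclusion is normalised so that \<open>x\<close>, \<open>y\<close> are the neighbours of
  \<open>v\<close> on the cycle and \<open>w\<close> is opposite \<open>v\<close>.\<close>

lemma short_cycle_cases:
  assumes "cycle p" "3 \<le> length p" "length p \<le> 4" "v \<in> fst ` set p"
  obtains x y where "length p = 3" "x \<noteq> y" "edge v x" "edge v y" "edge x y"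
  | x y w where "length p = 4" "x \<noteq> y" "w \<noteq> v" "edge v x" "edge v y" "edge w x" "edge w y"
proof -
  obtain u where u: "awalk u p u" "distinct (tl (pawalk_verts u p))"
    using assms(1) unfolding cycle_def by blast
  have ev: "set p \<subseteq> parcs G" "pcas u p u" using u(1) unfolding awalk_def by blast+
  have "length p = 3 \<or> length p = 4" using assms by linarith
  thus thesis
  proof
    assume l: "length p = 3"
    then obtain e1 e2 e3 where p: "p = [e1, e2, e3]"
      by (auto simp: length_Suc_conv numeral_eq_Suc)
    obtain x y where e: "e1 = (u, x)" "e2 = (x, y)" "e3 = (y, u)"
      using ev(2) by (cases e1; cases e2; cases e3) (auto simp: p)
    have "edge u x" "edge x y" "edge y u" "distinct [x, y, u]" using ev(1) u(2) by (auto simp: p e)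
    moreover have "v = u \<or> v = x \<or> v = y" using assms(4) by (auto simp: p e)
    ultimately show thesis using that(1)[OF l] edge_sym by (metis distinct_length_2_or_more)
  next
    assume l: "length p = 4"
    then obtain e1 e2 e3 e4 where p: "p = [e1, e2, e3, e4]"
      by (auto simp: length_Suc_conv numeral_eq_Suc)
    obtain x y z where e: "e1 = (u, x)" "e2 = (x, y)" "e3 = (y, z)" "e4 = (z, u)"
      using ev(2) by (cases e1; cases e2; cases e3; cases e4) (auto simp: p)
    have "edge u x" "edge x y" "edge y z" "edge z u" "distinct [x, y, z, u]"
      using ev(1) u(2) by (auto simp: p e)
    moreover have "v = u \<or> v = x \<or> v = y \<or> v = z" using assms(4) by (auto simp: p e)
    ultimately show thesis using that(2)[OF l] edge_sym by (metis distinct_length_2_or_more)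
  qed
qed

lemma local_girth_leE:
  assumes "local_girth G v \<le> enat n"
  obtains p where "cycle p" "3 \<le> length p" "length p \<le> n" "v \<in> fst ` set p"
proof -
  \<comment> \<open>A strict bound on the infimum yields a cycle as witness.\<close>
  have "local_girth G v < enat (Suc n)" using assms by (simp add: le_less_trans)
  then obtain p where "cycle p" "3 \<le> length p" "v \<in> fst ` set p" "enat (length p) < enat (Suc n)"
    unfolding local_girth_def INF_less_iff by blast
  thus ?thesis using that by simp
qed

lemma card_three_in_verts: "card {w. edge v w} = 3 \<Longrightarrow> v \<in> pverts G"
  using in_arcsD1 by (metis (no_types, lifting) card.empty empty_Collect_eq zero_neq_numeral)

lemma local_girth_le_g3:
  assumes "card {w. edge v w} = 3"
  shows "local_girth G v \<le> g3 G"
  unfolding g3_def using assms card_three_in_verts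
  by (intro SUP_upper) (simp add: vdegree_eq_card)

end

section \<open>Transfer from closed vertex sets to the graph\<close>

locale subcubic_pair_graph = pair_graph G + subcubic_relation edge
  for G :: "'a pair_pre_digraph"
begin

lemma awalk_imp_near: "awalk u p v \<Longrightarrow> near (length p) u v"
proof (induction p arbitrary: u)
  case Nil thus ?case by (simp add: awalk_def)
next
  case (Cons e p)
  obtain x y where e: "e = (x, y)" by fastforce
  thus ?case using Cons by (auto simp: awalk_Cons_iff)
qed

lemma gdist_greater:
  assumes "\<not> near s u v"
  shows "gdist G u v > ereal (real s)"
proof (rule ccontr)
  assume "\<not> ?thesis"
  hence "gdist G u v \<le> ereal (real s)" by simp
  \<comment> \<open>Passing to a strict bound gives a walk of length below \<open>s + 1\<close>, and
    an integral length is then at most \<open>s\<close>.\<close>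
  also have "\<dots> < ereal (real (Suc s))" by simp
  finally obtain p where p: "awalk u p v" "ereal (awalk_cost (\<lambda>_. 1) p) < ereal (real (Suc s))"
    unfolding gdist_def \<mu>_def INF_less_iff by blast
  have "awalk_cost (\<lambda>_. 1) p = real (length p)" by (simp add: awalk_cost_def sum_list_triv)
  hence "length p \<le> s" using p(2) by simp
  thus False using assms near_mono awalk_imp_near[OF p(1)] by blast
qed

lemma packing_colorableI:
  assumes "pack_colorable_on S (pverts G)"
  shows "packing_colorable S G"
proof -
  obtain c where c: "\<forall>u\<in>pverts G. c u < length S \<and>
     (\<forall>w\<in>pverts G. u \<noteq> w \<longrightarrow> c u = c w \<longrightarrow> \<not> near (S ! c u) u w)"
    using assms unfolding pack_colorable_on_def by blast
  define V where "V i = {u \<in> pverts G. c u = i}" for i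
  have "(\<Union>i < length S. V i) = pverts G" using c by (auto simp: V_def)
  moreover have "disjoint_family_on V {..<length S}" by (auto simp: disjoint_family_on_def V_def)
  moreover have "gdist G u v > ereal (real (S ! i))" if "u \<in> V i" "v \<in> V i" "u \<noteq> v" for i u v
  proof -
    have "u \<in> pverts G" "v \<in> pverts G" "c u = i" "c v = i" using that by (simp_all add: V_def)
    hence "\<not> near (S ! i) u v" using c that(3) by metis
    thus ?thesis by (rule gdist_greater)
  qed
  ultimately show ?thesis unfolding packing_colorable_def by blast
qed

lemma adj_closed_pverts: "adj_closed (pverts G)"
  using in_arcsD2 by (auto simp: adj_closed_def)

lemma reachable_in_adj_closed:
  assumes "adj_closed Z" "u \<in> Z" "u \<rightarrow>\<^sup>*\<^bsub>with_proj G\<^esub> v"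
  shows "v \<in> Z"
  using assms(3)
proof (induction rule: reachable_induct)
  case base thus ?case using assms(2) by simp
next
  case (step x y)
  hence "edge x y" by simp
  thus ?case using step assms(1) adj_closedD by blast
qed

text \<open>Closedness makes \<open>Z\<close> exactly the set reachable from \<open>a\<close>, and
  together with the missing chords it determines all arcs on \<open>Z\<close>.\<close>

lemma G1_on_imp_component:
  assumes "G1_on Z" "Z \<subseteq> pverts G" "adj_closed Z"
  shows "has_G1_component G"
proof -
  obtain a b c d e f where C5: "is_C5 a b c d e" and f: "f \<notin> {a, b, c, d, e}" "nbs f = {a, c}"
    and Z: "Z = {a, b, c, d, e, f}" using assms(1) unfolding G1_on_def by blast
  have dist: "distinct [a, b, c, d, e, f]" using C5 f by (auto simp: is_C5_def)
  note f_iff = adj_iff_two[OF f(2)]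
  have a: "a \<in> pverts G" using assms(2) Z by blast
  have e: "edge a b" "edge b c" "edge c d" "edge d e" "edge e a" "edge f a" "edge f c"
    using C5 f_iff by (auto simp: is_C5_def)
  have ne: "\<not> edge a c" "\<not> edge b d" "\<not> edge c e" "\<not> edge d a" "\<not> edge e b"
    "\<not> edge f b" "\<not> edge f d" "\<not> edge f e"
    using C5 f_iff dist by (auto simp: is_C5_def)
  have reach: "{v. a \<rightarrow>\<^sup>*\<^bsub>with_proj G\<^esub> v} = Z"
  proof
    show "{v. a \<rightarrow>\<^sup>*\<^bsub>with_proj G\<^esub> v} \<subseteq> Z" using reachable_in_adj_closed[OF assms(3)] Z by blast
    have "a \<rightarrow>\<^sup>*\<^bsub>with_proj G\<^esub> a" using a by simp
    moreover have step: "a \<rightarrow>\<^sup>*\<^bsub>with_proj G\<^esub> w" if "a \<rightarrow>\<^sup>*\<^bsub>with_proj G\<^esub> u" "edge u w" for u w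
      using that reachable_adj_trans by simp
    ultimately have "a \<rightarrow>\<^sup>*\<^bsub>with_proj G\<^esub> b" "a \<rightarrow>\<^sup>*\<^bsub>with_proj G\<^esub> f" using e edge_sym by blast+
    moreover from this have "a \<rightarrow>\<^sup>*\<^bsub>with_proj G\<^esub> c" using step e by blast
    moreover from this have "a \<rightarrow>\<^sup>*\<^bsub>with_proj G\<^esub> d" using step e by blast
    moreover from this have "a \<rightarrow>\<^sup>*\<^bsub>with_proj G\<^esub> e" using step e by blast
    ultimately show "Z \<subseteq> {v. a \<rightarrow>\<^sup>*\<^bsub>with_proj G\<^esub> v}" using \<open>a \<rightarrow>\<^sup>*\<^bsub>with_proj G\<^esub> a\<close> Z by blast
  qed
  let ?H = "with_proj G \<restriction> Z"
  have "?H \<in> sccs" using induce_reachable_is_in_sccs[of a] a reach by simp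
  moreover have "digraph_iso ?H (with_proj graph_G1)"
  proof -
    \<comment> \<open>In \<open>graph_G1\<close> the 3-vertices are 3 and 5, with the twins 4 and 6
      between them; hence \<open>a\<close>, \<open>c\<close> go to 3, 5 and \<open>b\<close>,
      \<open>f\<close> to 4, 6.\<close>
    define h :: "'a \<Rightarrow> nat" where
      "h x = (if x = a then 3 else if x = b then 4 else if x = c then 5 else if x = d then 1
        else if x = e then 2 else 6)" for x
    have h: "h a = 3" "h b = 4" "h c = 5" "h d = 1" "h e = 2" "h f = 6"
      using dist by (auto simp: h_def)
    \<comment> \<open>The arcs are listed so that their images under \<open>h\<close> match the list
      in \<open>graph_G1\<close> term by term.\<close>
    define F where "F = {(d, e), (e, a), (a, b), (b, c), (c, d), (c, f), (a, f)}"
    have symF: "symcl F = {(d, e), (e, a), (a, b), (b, c), (c, d), (c, f), (a, f),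
        (e, d), (a, e), (b, a), (c, b), (d, c), (f, c), (f, a)}"
      by (auto simp: F_def symcl_def)
    have arcs: "arcs ?H = symcl F"
    proof
      show "symcl F \<subseteq> arcs ?H" using e edge_sym Z by (auto simp: F_def symcl_def)
      show "arcs ?H \<subseteq> symcl F"
      proof
        fix xy assume xy: "xy \<in> arcs ?H"
        obtain x y where xy': "xy = (x, y)" by fastforce
        have xyZ: "edge x y" "x \<in> Z" "y \<in> Z" using xy by (auto simp: xy')
        have ne': "\<not> edge c a" "\<not> edge d b" "\<not> edge e c" "\<not> edge a d" "\<not> edge b e"
          "\<not> edge b f" "\<not> edge d f" "\<not> edge e f" using ne edge_sym by blast+
        show "xy \<in> symcl F" using xyZ ne ne' adj_irrefl unfolding Z xy' symF
          by (elim insertE emptyE) simp_all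
      qed
    qed
    let ?hom = "\<lparr> iso_verts = h, iso_arcs = map_prod h h, iso_head = snd, iso_tail = fst \<rparr>"
    have inj: "inj_on h Z" using h dist by (auto simp: Z inj_on_def)
    have "inj_on (map_prod h h) (Z \<times> Z)" using map_prod_inj_on[OF inj inj] .
    hence inj': "inj_on (map_prod h h) (arcs ?H)" by (rule inj_on_subset) auto
    have "wf_digraph ?H" by (rule wellformed_induce_subgraph)
    hence "pre_digraph.digraph_isomorphism ?H ?hom"
      unfolding pre_digraph.digraph_isomorphism_def using inj inj' by auto
    moreover have "with_proj graph_G1 = app_iso ?hom ?H"
    proof -
      have "h ` Z = {1..6}" unfolding Z using h by auto
      moreover have "map_prod h h ` symcl F =
          symcl {(1,2), (2,3), (3,4), (4,5), (5,1), (5,6), (3,6)}"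
        unfolding symcl_def F_def image_Un using h by auto
      ultimately show ?thesis
        unfolding app_iso_def with_proj_def graph_G1_def
        using arcs by (simp add: with_proj_def)
    qed
    ultimately show ?thesis unfolding digraph_iso_def by blast
  qed
  ultimately show ?thesis unfolding has_G1_component_def by blast
qed

text \<open>A piece of shape \<open>G1_on\<close> obstructs only the third list; being closed, it is
  a component, which the assumption there rules out.\<close>

lemma colorable_of_pieces:
  assumes piece: "\<And>X k. finite X \<Longrightarrow> adj_closed X \<Longrightarrow> X \<noteq> {} \<Longrightarrow>
    \<exists>Z\<subseteq>X. Z \<noteq> {} \<and> adj_closed Z \<and> pack_colorable_on [1, 1, 3, k] Z \<and>
      pack_colorable_on [1, 2, 2, 3] Z \<and> (pack_colorable_on [2, 2, 2, 2, 3] Z \<or> G1_on Z) \<and>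
      pack_colorable_on [1, 2, 3, 4, 5, k] Z"
  shows "packing_colorable [1, 1, 3, k] G" "packing_colorable [1, 2, 2, 3] G"
    "\<not> has_G1_component G \<Longrightarrow> packing_colorable [2, 2, 2, 2, 3] G"
    "packing_colorable [1, 2, 3, 4, 5, k] G"
proof -
  have fin: "finite Y" if "Y \<subseteq> pverts G" for Y using that pair_finite_verts finite_subset by blast
  note pieces = packing_colorableI[OF pack_colorable_on_pieces[OF pair_finite_verts adj_closed_pverts]]
  show "packing_colorable [1, 1, 3, k] G"
  proof (rule pieces)
    fix Y assume Y: "Y \<subseteq> pverts G" "adj_closed Y" "Y \<noteq> {}"
    show "\<exists>Z\<subseteq>Y. Z \<noteq> {} \<and> adj_closed Z \<and> pack_colorable_on [1, 1, 3, k] Z"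
      using piece[OF fin[OF Y(1)] Y(2,3), of k] by blast
  qed
  show "packing_colorable [1, 2, 2, 3] G"
  proof (rule pieces)
    fix Y assume Y: "Y \<subseteq> pverts G" "adj_closed Y" "Y \<noteq> {}"
    show "\<exists>Z\<subseteq>Y. Z \<noteq> {} \<and> adj_closed Z \<and> pack_colorable_on [1, 2, 2, 3] Z"
      using piece[OF fin[OF Y(1)] Y(2,3), of k] by blast
  qed
  show "packing_colorable [1, 2, 3, 4, 5, k] G"
  proof (rule pieces)
    fix Y assume Y: "Y \<subseteq> pverts G" "adj_closed Y" "Y \<noteq> {}"
    show "\<exists>Z\<subseteq>Y. Z \<noteq> {} \<and> adj_closed Z \<and> pack_colorable_on [1, 2, 3, 4, 5, k] Z"
      using piece[OF fin[OF Y(1)] Y(2,3), of k] by blast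
  qed
  show "packing_colorable [2, 2, 2, 2, 3] G" if "\<not> has_G1_component G"
  proof (rule pieces)
    fix Y assume Y: "Y \<subseteq> pverts G" "adj_closed Y" "Y \<noteq> {}"
    then obtain Z where "Z \<subseteq> Y" "Z \<noteq> {}" "adj_closed Z"
      "pack_colorable_on [2, 2, 2, 2, 3] Z \<or> G1_on Z" using piece[OF fin[OF Y(1)] Y(2,3)] by meson
    thus "\<exists>Z\<subseteq>Y. Z \<noteq> {} \<and> adj_closed Z \<and> pack_colorable_on [2, 2, 2, 2, 3] Z"
      using G1_on_imp_component[of Z] that Y(1) by blast
  qed
qed

lemma saturated_card:
  assumes "saturated k G" "card (nbs v) = 3"
  shows "card {u. edge v u \<and> card (nbs u) = 3} \<le> k"
proof -
  have v: "v \<in> pverts G" using assms(2) card_three_in_verts by (simp add: nbs_def)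
  have "{u \<in> pverts G. edge v u \<and> vdegree G u = 3} = {u. edge v u \<and> card (nbs u) = 3}"
    using in_arcsD2 by (auto simp: vdegree_eq_card nbs_def)
  thus ?thesis using assms v by (auto simp: saturated_def vdegree_eq_card nbs_def)
qed

lemma finite_three_nbs: "finite {u. edge v u \<and> card (nbs u) = 3}"
  using finite_edge[of v] by (rule rev_finite_subset) blast

end

theorem theorem1:
  fixes G :: "'a pair_pre_digraph"
  assumes "pair_graph G"
    and "subcubic G"
    and "(saturated 0 G \<and> g3 G \<le> 4) \<or> (saturated 1 G \<and> g3 G = 3)"
  shows "(\<forall>k::nat. k \<ge> 3 \<longrightarrow> packing_colorable [1, 1, 3, k] G) \<and>
         packing_colorable [1, 2, 2, 3] G \<and>
         (\<not> has_G1_component G \<longrightarrow> packing_colorable [2, 2, 2, 2, 3] G) \<and>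
         (\<forall>k::nat. k \<ge> 6 \<longrightarrow> packing_colorable [1, 2, 3, 4, 5, k] G)"
proof -
  interpret pair_graph G by fact
  interpret subcubic_relation edge using assms(2) by (rule subcubic_relation_edge)
  interpret subcubic_pair_graph G by unfold_locales
  have "\<exists>Z\<subseteq>X. Z \<noteq> {} \<and> adj_closed Z \<and> pack_colorable_on [1, 1, 3, k] Z \<and>
      pack_colorable_on [1, 2, 2, 3] Z \<and> (pack_colorable_on [2, 2, 2, 2, 3] Z \<or> G1_on Z) \<and>
      pack_colorable_on [1, 2, 3, 4, 5, k] Z" if X: "finite X" "adj_closed X" "X \<noteq> {}" for X k
    using assms(3)
  proof
    assume a: "saturated 0 G \<and> g3 G \<le> 4"
    show ?thesis
    proof (rule sparse_colorable_piece[OF X])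
      have "card {u. edge v u \<and> card (nbs u) = 3} = 0" if "card (nbs v) = 3" for v
        using saturated_card[of 0 v] a that by simp
      thus "\<forall>v w. edge v w \<longrightarrow> card (nbs v) = 3 \<longrightarrow> card (nbs w) \<noteq> 3"
        using finite_three_nbs by auto
    next
      fix v assume v: "card (nbs v) = 3"
      have "local_girth G v \<le> enat 4"
        using order_trans[OF local_girth_le_g3[of v], of "enat 4"] v a by (simp add: nbs_def numeral_eq_enat)
      then obtain p where p: "cycle p" "3 \<le> length p" "length p \<le> 4" "v \<in> fst ` set p"
        using local_girth_leE by blast
      show "\<exists>x y. edge v x \<and> edge v y \<and> x \<noteq> y \<and> (edge x y \<or> (\<exists>w. w \<noteq> v \<and> edge w x \<and> edge w y))"
        by (rule short_cycle_cases[OF p]) blast+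
    qed
  next
    assume b: "saturated 1 G \<and> g3 G = 3"
    show ?thesis
    proof (rule triangle_colorable_piece[OF X])
      have "card {u. edge v u \<and> card (nbs u) = 3} \<le> 1" if "card (nbs v) = 3" for v
        using saturated_card[of 1 v] b that by simp
      hence "x = y" if "card (nbs v) = 3" "edge v x" "edge v y" "card (nbs x) = 3" "card (nbs y) = 3"
        for v x y
        using that finite_three_nbs[of v] card_le_Suc0_iff_eq[of "{u. edge v u \<and> card (nbs u) = 3}"]
        by auto
      thus "\<forall>v x y. card (nbs v) = 3 \<longrightarrow> edge v x \<longrightarrow> edge v y \<longrightarrow> card (nbs x) = 3 \<longrightarrow>
          card (nbs y) = 3 \<longrightarrow> x = y" by blast
    next
      fix v assume v: "card (nbs v) = 3"
      have "local_girth G v \<le> enat 3"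
        using order_trans[OF local_girth_le_g3[of v], of "enat 3"] v b by (simp add: nbs_def numeral_eq_enat)
      then obtain p where p: "cycle p" "3 \<le> length p" "length p \<le> 3" "v \<in> fst ` set p"
        using local_girth_leE by blast
      hence "length p \<le> 4" "length p \<noteq> 4" by simp_all
      thus "\<exists>x y. edge v x \<and> edge v y \<and> edge x y"
        using short_cycle_cases[OF p(1,2) _ p(4)] by metis
    qed
  qed
  thus ?thesis using colorable_of_pieces by blast
qed

end
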